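(* The number of polygonizations that a double chain $D$ of $N=2n$ points admits is at most $O(5.610718614^N)$.
   Context: A polygonization of a finite point set in the plane is a non-crossing Hamiltonian cycle on it, i.e. a simple polygon whose vertex set is exactly the point set, with straight-line edges no two of which cross. A double chain of $N=2n$ points is a set of points in the plane such that: $n$ of the points lie on an upper convex chain $U$ and the other $n$ lie on a lower convex chain $L$, the two chains having opposite concavity; for every pair of points of $U$, the line through them leaves all points of $L$ below it; and for every pair of points of $L$, the line through them leaves all points of $U$ above it. *)

theory Defs
  imports "HOL-Analysis.Analysis"
begin

type_synonym point = "real \<times> real"

text \<open>Orientation (cross product) of q - p and r - p.  For fst p < fst q,
  the point r lies strictly above the line through p and q iff orient p q r > 0
  and strictly below iff orient p q r < 0.\<close>
definition orient :: "point \<Rightarrow> point \<Rightarrow> point \<Rightarrow> real" where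
  "orient p q r = (fst q - fst p) * (snd r - snd p) - (snd q - snd p) * (fst r - fst p)"

definition ham_cycle :: "point list \<Rightarrow> point set \<Rightarrow> bool" where
  "ham_cycle vs P \<longleftrightarrow> distinct vs \<and> set vs = P \<and> length vs \<ge> 3"

definition cyc_edge :: "point list \<Rightarrow> nat \<Rightarrow> point set" where
  "cyc_edge vs i = {vs ! i, vs ! ((i + 1) mod length vs)}"

definition cycle_edges :: "point list \<Rightarrow> point set set" where
  "cycle_edges vs = cyc_edge vs ` {..<length vs}"

definition seg :: "point list \<Rightarrow> nat \<Rightarrow> point set" where
  "seg vs i = closed_segment (vs ! i) (vs ! ((i + 1) mod length vs))"

text \<open>Non-crossing: non-adjacent edges are disjoint, adjacent edges meet only
  in their common endpoint (i.e. the cycle bounds a simple polygon).\<close>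
definition non_crossing :: "point list \<Rightarrow> bool" where
  "non_crossing vs \<longleftrightarrow>
     (\<forall>i < length vs. \<forall>j < length vs. i \<noteq> j \<longrightarrow>
        seg vs i \<inter> seg vs j = cyc_edge vs i \<inter> cyc_edge vs j)"

definition polygonizations :: "point set \<Rightarrow> point set set set" where
  "polygonizations P = {E. \<exists>vs. ham_cycle vs P \<and> non_crossing vs \<and> E = cycle_edges vs}"

definition cap_chain :: "point set \<Rightarrow> bool" where
  "cap_chain C \<longleftrightarrow> inj_on fst C \<and>
     (\<forall>a\<in>C. \<forall>b\<in>C. \<forall>c\<in>C. fst a < fst b \<and> fst b < fst c \<longrightarrow> orient a c b > 0)"

definition cup_chain :: "point set \<Rightarrow> bool" where
  "cup_chain C \<longleftrightarrow> inj_on fst C \<and>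
     (\<forall>a\<in>C. \<forall>b\<in>C. \<forall>c\<in>C. fst a < fst b \<and> fst b < fst c \<longrightarrow> orient a c b < 0)"

definition double_chain :: "point set \<Rightarrow> point set \<Rightarrow> nat \<Rightarrow> bool" where
  "double_chain U L n \<longleftrightarrow>
     finite U \<and> finite L \<and> card U = n \<and> card L = n \<and> U \<inter> L = {} \<and>
     ((cap_chain U \<and> cup_chain L) \<or> (cup_chain U \<and> cap_chain L)) \<and>
     (\<forall>a\<in>U. \<forall>b\<in>U. fst a < fst b \<longrightarrow> (\<forall>l\<in>L. orient a b l < 0)) \<and>
     (\<forall>a\<in>L. \<forall>b\<in>L. fst a < fst b \<longrightarrow> (\<forall>u\<in>U. orient a b u > 0))"

end

theory Submission
  imports Defs
begin

text \<open>Two disjoint edges between the chains cross as soon as their ends come in opposite orders, so the edges of a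
  polygonization running between \<open>U\<close> and \<open>L\<close> form a staircase, which is determined by its vertex
  degrees. As every vertex has degree 2, a polygonization is therefore determined by the edges
  it has inside \<open>U\<close> and inside \<open>L\<close>. Those inside \<open>U\<close> form a crossing-free system of disjoint paths
  on \<open>n\<close> points in convex position. Such systems are noncrossing partitions whose \<open>m\<close>-element blocks carry
  one of the \<open>m 2\<^sup>m\<^sup>-\<^sup>3\<close> crossing-free Hamiltonian paths (one path if \<open>m = 1\<close>), so their number grows like
  \<open>\<rho>\<^sup>n\<close> with \<open>\<rho> = min \<phi>(t)/t\<close> over \<open>0 < t < 1/2\<close> and \<open>\<phi>(t) = 1 + 3t/4 + t/(4(1-2t)\<^sup>2)\<close>;
  numerically \<open>\<rho> < 5.610718614\<close>.\<close>

subsection \<open>Crossing-free Hamiltonian paths\<close>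

fun path_edges :: "'a list \<Rightarrow> 'a set set" where
  "path_edges (x # y # r) = insert {x, y} (path_edges (y # r))"
| "path_edges _ = {}"

text \<open>Convex position enters the counting only through the order of abscissae: two chords of a
  chain with interleaving ends meet. Pairs that share an end never count as crossing.\<close>

definition crossing :: "'a::linorder set \<Rightarrow> 'a set \<Rightarrow> bool" where
  "crossing e f \<longleftrightarrow> (\<exists>a b c d. a < b \<and> b < c \<and> c < d \<and>
     (e = {a, c} \<and> f = {b, d} \<or> e = {b, d} \<and> f = {a, c}))"

definition crossing_free :: "'a::linorder set set \<Rightarrow> bool" where
  "crossing_free E \<longleftrightarrow> (\<forall>e\<in>E. \<forall>f\<in>E. \<not> crossing e f)"

text \<open>One-element lists stand for isolated points. The empty list may be a member as well; it
  has no edges, and only edge sets are counted later.\<close>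

definition path_system :: "'a list set \<Rightarrow> 'a set \<Rightarrow> bool" where
  "path_system P S \<longleftrightarrow> (\<forall>p\<in>P. distinct p) \<and>
     (\<forall>p\<in>P. \<forall>q\<in>P. p \<noteq> q \<longrightarrow> set p \<inter> set q = {}) \<and> \<Union> (set ` P) = S"

definition system_edges :: "'a list set \<Rightarrow> 'a set set" where
  "system_edges P = \<Union> (path_edges ` P)"

definition forests :: "'a::linorder set \<Rightarrow> 'a set set set" where
  "forests S = {system_edges P |P. path_system P S \<and> crossing_free (system_edges P)}"

lemma crossing_commute: "crossing e f \<longleftrightarrow> crossing f e"
  unfolding crossing_def by blast

lemma crossingI: "a < b \<Longrightarrow> b < c \<Longrightarrow> c < d \<Longrightarrow> crossing {a, c} {b, d}"
  unfolding crossing_def by blast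

lemma crossing_free_subset: "crossing_free F \<Longrightarrow> E \<subseteq> F \<Longrightarrow> crossing_free E"
  unfolding crossing_free_def by blast

lemma hd_neq_last:
  assumes "distinct p" "length p \<ge> 2"
  shows "hd p \<noteq> last p"
proof (cases p)
  case (Cons x xs)
  then have "xs \<noteq> []" "x \<notin> set xs" using assms by auto
  then show ?thesis using Cons last_in_set[of xs] by auto
qed (use assms in simp)

lemma path_edges_subset: "e \<in> path_edges p \<Longrightarrow> e \<subseteq> set p"
  by (induction p rule: path_edges.induct) auto

lemma path_edges_Cons: "xs \<noteq> [] \<Longrightarrow> path_edges (x # xs) = insert {x, hd xs} (path_edges xs)"
  by (cases xs) auto

lemma path_edges_Cons_mono: "path_edges xs \<subseteq> path_edges (x # xs)"
  by (cases xs) auto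

lemma path_edges_snoc: "xs \<noteq> [] \<Longrightarrow> path_edges (xs @ [x]) = insert {last xs, x} (path_edges xs)"
  by (induction xs rule: path_edges.induct) auto

lemma path_edges_rev: "path_edges (rev p) = path_edges p"
proof (induction p)
  case (Cons x xs)
  then show ?case
    by (cases "xs = []") (auto simp: path_edges_Cons path_edges_snoc last_rev insert_commute)
qed simp

lemma path_edges_pair:
  "e \<in> path_edges p \<Longrightarrow> distinct p \<Longrightarrow> \<exists>x y. e = {x, y} \<and> x \<noteq> y \<and> x \<in> set p \<and> y \<in> set p"
  by (induction p rule: path_edges.induct) auto

text \<open>A discrete intermediate value principle, the source of every separation argument below:
  walking from a point with \<open>Q\<close> to one without, the path changes sides along some
  edge.\<close>

lemma path_edges_change:
  assumes "x \<in> set p" "y \<in> set p" "Q x" "\<not> Q y"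
  shows "\<exists>u v. {u, v} \<in> path_edges p \<and> u \<in> set p \<and> v \<in> set p \<and> Q u \<and> \<not> Q v"
  using assms
proof (induction p arbitrary: x y rule: path_edges.induct)
  case (1 a b r)
  show ?case
  proof (cases "Q a = Q b")
    case True
    then have "\<exists>x y. x \<in> set (b # r) \<and> y \<in> set (b # r) \<and> Q x \<and> \<not> Q y"
      using "1.prems" by (cases "Q a") auto
    then show ?thesis
      using "1.IH" by fastforce
  next
    case False
    then show ?thesis
      by (cases "Q a") (auto simp: insert_commute)
  qed
qed auto

text \<open>The crude double exponential bound serves to make the supremum in
  \<open>forest_count\<close> a supremum of a bounded set.\<close>

lemma finite_forests:
  assumes "finite S"
  shows "finite (forests S)" "card (forests S) \<le> 2 ^ 2 ^ card S"
proof -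
  have "forests S \<subseteq> Pow (Pow S)"
    unfolding forests_def path_system_def system_edges_def using path_edges_subset by fastforce
  moreover have "card (Pow (Pow S)) = 2 ^ 2 ^ card S" "finite (Pow (Pow S))"
    using assms by (simp_all add: card_Pow)
  ultimately show "finite (forests S)" "card (forests S) \<le> 2 ^ 2 ^ card S"
    by (metis finite_subset, metis card_mono)
qed

section \<open>Counting crossing-free Hamiltonian paths in convex position\<close>

definition ham_paths :: "'a::linorder set \<Rightarrow> 'a list set" where
  "ham_paths B = {p. distinct p \<and> set p = B \<and> crossing_free (path_edges p)}"

text \<open>Candidate continuations of a path whose unvisited points form the arc \<open>R\<close>:
  each step consumes one of the two ends.\<close>

function peelings :: "'a list \<Rightarrow> 'a list set" where
  "peelings [] = {[]}"
| "R \<noteq> [] \<Longrightarrow> peelings R = (#) (hd R) ` peelings (tl R) \<union> (#) (last R) ` peelings (butlast R)"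
  by auto
termination by (relation "Wellfounded.measure length") auto

declare peelings.simps(2) [simp del]

text \<open>Each step chooses between two ends, except that a single remaining point is both ends of
  its arc; this saves one factor 2.\<close>

lemma card_peelings: "finite (peelings R) \<and> card (peelings R) \<le> 2 ^ (length R - 1)"
proof (induction R rule: peelings.induct)
  case (2 R)
  show ?case
  proof (cases "tl R = []")
    case True
    then obtain x where "R = [x]"
      using 2(1) by (cases R) auto
    then show ?thesis by (simp add: peelings.simps(2))
  next
    case False
    let ?A = "(#) (hd R) ` peelings (tl R)" and ?B = "(#) (last R) ` peelings (butlast R)"
    have len: "length R \<ge> 2"
      using False by (cases R) (auto simp: Suc_le_eq)
    have "card ?A \<le> 2 ^ (length R - 2)" "card ?B \<le> 2 ^ (length R - 2)"
      using 2 by (auto intro!: order.trans[OF card_image_le] simp: numeral_2_eq_2)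
    then have "card (?A \<union> ?B) \<le> 2 ^ (length R - 2) + 2 ^ (length R - 2)"
      using card_Un_le[of ?A ?B] by linarith
    also have "\<dots> = 2 ^ (length R - 1)"
      using len by (metis Suc_diff_le diff_Suc_Suc mult_2 numeral_2_eq_2 power_Suc One_nat_def)
    finally show ?thesis
      using 2 by (simp add: peelings.simps(2))
  qed
qed simp

text \<open>This and \<open>cyclic_list\<close> express circular order by crossing chords, which
  hides the place where the linear order wraps around: a chord from \<open>s\<close> into the middle
  of \<open>R\<close> separates the entries before it from those after it.\<close>

definition cyclic_from :: "'a::linorder \<Rightarrow> 'a list \<Rightarrow> bool" where
  "cyclic_from s R \<longleftrightarrow>
     (\<forall>i j k. i < j \<and> j < k \<and> k < length R \<longrightarrow> crossing {s, R ! j} {R ! i, R ! k})"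

definition cyclic_list :: "'a::linorder list \<Rightarrow> bool" where
  "cyclic_list R \<longleftrightarrow> (\<forall>i j k l. i < j \<and> j < k \<and> k < l \<and> l < length R \<longrightarrow>
     crossing {R ! i, R ! k} {R ! j, R ! l})"

lemma cyclic_list_tl: "cyclic_list R \<Longrightarrow> cyclic_list (tl R)"
  unfolding cyclic_list_def by (auto simp: nth_tl)

lemma cyclic_list_butlast: "cyclic_list R \<Longrightarrow> cyclic_list (butlast R)"
  unfolding cyclic_list_def by (auto simp: nth_butlast)

text \<open>Restores the invariant of the peeling: after a step to an end of the arc, the rest is an
  arc seen from the new position.\<close>

lemma cyclic_from_hd:
  assumes "cyclic_list R" "R \<noteq> []"
  shows "cyclic_from (hd R) (tl R)"
  unfolding cyclic_from_def
proof (intro allI impI)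
  fix i j k assume *: "i < j \<and> j < k \<and> k < length (tl R)"
  have "crossing {R ! 0, R ! Suc j} {R ! Suc i, R ! Suc k}"
    using assms(1) * unfolding cyclic_list_def by auto
  then show "crossing {hd R, tl R ! j} {tl R ! i, tl R ! k}"
    using * assms(2) by (auto simp: nth_tl hd_conv_nth)
qed

lemma cyclic_from_last:
  assumes "cyclic_list R" "R \<noteq> []"
  shows "cyclic_from (last R) (butlast R)"
  unfolding cyclic_from_def
proof (intro allI impI)
  fix i j k assume *: "i < j \<and> j < k \<and> k < length (butlast R)"
  have "crossing {R ! i, R ! k} {R ! j, R ! (length R - 1)}"
    using assms(1) * unfolding cyclic_list_def by auto
  then show "crossing {last R, butlast R ! j} {butlast R ! i, butlast R ! k}"
    using * assms(2) by (auto simp: nth_butlast last_conv_nth insert_commute crossing_commute)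
qed

text \<open>A crossing-free Hamiltonian path in convex position that has visited the complement of an arc
  must continue at an end of that arc: an interior vertex would separate the unvisited vertices.\<close>
lemma path_in_peelings:
  assumes "distinct (s # q)" "set q = set R" "distinct R" "crossing_free (path_edges (s # q))"
    "cyclic_from s R" "cyclic_list R"
  shows "q \<in> peelings R"
  using assms
proof (induction q arbitrary: s R)
  case Nil
  then show ?case by simp
next
  case (Cons v q)
  then have ne: "R \<noteq> []" by auto
  from Cons.prems have nc: "crossing_free (path_edges (v # q))"
    by (auto simp: path_edges_Cons intro: crossing_free_subset)
  have "v \<in> set R" using Cons.prems by auto
  then obtain j where j: "j < length R" "v = R ! j" by (auto simp: in_set_conv_nth)
  have "v = hd R \<or> v = last R"
  proof (rule ccontr)
    assume neg: "\<not> (v = hd R \<or> v = last R)"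
    then have "0 < j" "j < length R - 1"
      using j ne by (auto simp: hd_conv_nth last_conv_nth nat_neq_iff intro: gr0I)
        (metis One_nat_def Suc_pred length_greater_0_conv less_antisym)
    have q: "set q = set R - {v}" using Cons.prems by auto
    have "hd R \<in> set q" "last R \<in> set q"
      using neg ne q by auto
    moreover have "hd R \<in> set (take j R)"
      using ne \<open>0 < j\<close> by (cases R) (auto simp: take_Cons')
    moreover have "last R \<notin> set (take j R)"
    proof
      assume "last R \<in> set (take j R)"
      then obtain i where "i < j" "R ! i = R ! (length R - 1)"
        using ne j by (auto simp: in_set_conv_nth last_conv_nth)
      then show False
        using \<open>j < length R - 1\<close> Cons.prems(3) by (auto simp: nth_eq_iff_index_eq)
    qed
    \<comment> \<open>The path \<open>q\<close> avoids \<open>v\<close> but visits both ends of the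
      arc, so one of its edges leaves the prefix before \<open>v\<close>; that edge crosses
      \<open>{s, v}\<close>.\<close>
    ultimately obtain x y where xy: "{x, y} \<in> path_edges q" "x \<in> set q" "y \<in> set q"
      "x \<in> set (take j R)" "y \<notin> set (take j R)"
      using path_edges_change[of "hd R" q "last R" "\<lambda>x. x \<in> set (take j R)"] by blast
    obtain i where i: "i < j" "x = R ! i"
      using xy j by (auto simp: in_set_conv_nth)
    have "y \<in> set R" "y \<noteq> v" using xy q by auto
    then obtain k where k: "k < length R" "y = R ! k" "k \<noteq> j"
      using j by (auto simp: in_set_conv_nth)
    moreover have "\<not> k < j"
      using xy k j by (auto simp: in_set_conv_nth)
    ultimately have "crossing {s, v} {x, y}"
      using Cons.prems(5) i j k unfolding cyclic_from_def by auto
    moreover have "{s, v} \<in> path_edges (s # v # q)" "{x, y} \<in> path_edges (s # v # q)"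
      using xy path_edges_Cons_mono[of q v] by auto
    ultimately show False
      using Cons.prems(4) unfolding crossing_free_def by blast
  qed
  then show ?case
  proof
    assume v: "v = hd R"
    then have "R = v # tl R" using ne by simp
    then have "distinct (v # tl R)" "set (v # q) = set (v # tl R)"
      using Cons.prems(2,3) by metis+
    then have "set q = set (tl R)"
      using Cons.prems(1) by (simp add: insert_ident)
    then have "q \<in> peelings (tl R)"
      using Cons.prems(1,3,6) nc cyclic_from_hd[OF Cons.prems(6) ne] v
      by (intro Cons.IH[of v]) (simp_all add: cyclic_list_tl distinct_tl)
    then show ?thesis
      using peelings.simps(2)[OF ne] by (simp add: v)
  next
    assume v: "v = last R"
    have R: "R = butlast R @ [v]" using v ne by simp
    then have "distinct (butlast R @ [v])" "set (v # q) = set (butlast R @ [v])"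
      using Cons.prems(2,3) by metis+
    then have "set q = set (butlast R)"
      using Cons.prems(1) by (simp add: insert_ident)
    then have "q \<in> peelings (butlast R)"
      using Cons.prems(1,3,6) nc cyclic_from_last[OF Cons.prems(6) ne] v
      by (intro Cons.IH[of v]) (simp_all add: cyclic_list_butlast distinct_butlast)
    then show ?thesis
      using peelings.simps(2)[OF ne] by (simp add: v)
  qed
qed

text \<open>Going up from \<open>s\<close> and then continuing from the bottom traverses the circle
  once. The cases are the positions of the wrap-around; in each of them the points, listed in
  increasing order, still interleave.\<close>

lemma cyclic_rotated:
  assumes "sorted_wrt (<) xs" "sorted_wrt (<) ys" "\<And>x. x \<in> set xs \<Longrightarrow> s < x" "\<And>y. y \<in> set ys \<Longrightarrow> y < s"
  shows "cyclic_from s (xs @ ys)" "cyclic_list (xs @ ys)"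
proof -
  let ?R = "xs @ ys" and ?n = "length xs"
  have xs: "?R ! i < ?R ! j" if "i < j" "j < ?n" for i j
    using that assms(1) by (auto simp: nth_append sorted_wrt_nth_less)
  have ys: "?R ! i < ?R ! j" if "\<not> i < ?n" "i < j" "j < length ?R" for i j
    using that assms(2) by (auto simp: nth_append sorted_wrt_nth_less)
  have xs': "s < ?R ! i" if "i < ?n" for i
    using that assms(3) by (auto simp: nth_append)
  have ys': "?R ! i < s" if "\<not> i < ?n" "i < length ?R" for i
    using that assms(4) by (auto simp: nth_append)
  have yx: "?R ! i < ?R ! j" if "\<not> i < ?n" "i < length ?R" "j < ?n" for i j
    using ys' xs' that by (meson order.strict_trans)
  show "cyclic_from s ?R"
    unfolding cyclic_from_def
  proof (intro allI impI)
    fix i j k assume *: "i < j \<and> j < k \<and> k < length ?R"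
    consider "k < ?n" | "\<not> k < ?n" "j < ?n" | "\<not> j < ?n" "i < ?n" | "\<not> i < ?n" by blast
    then show "crossing {s, ?R ! j} {?R ! i, ?R ! k}"
    proof cases
      case 1
      then show ?thesis using * xs xs' by (auto intro!: crossingI)
    next
      case 2
      then have "crossing {?R ! k, ?R ! i} {s, ?R ! j}"
        using * xs xs' ys' by (auto intro!: crossingI)
      then show ?thesis by (simp add: insert_commute crossing_commute)
    next
      case 3
      then have "crossing {?R ! j, s} {?R ! k, ?R ! i}"
        using * xs xs' ys' ys by (auto intro!: crossingI)
      then show ?thesis by (simp add: insert_commute crossing_commute)
    next
      case 4
      then have "crossing {?R ! i, ?R ! k} {?R ! j, s}"
        using * ys' ys by (auto intro!: crossingI)
      then show ?thesis by (simp add: insert_commute crossing_commute)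
    qed
  qed
  show "cyclic_list ?R"
    unfolding cyclic_list_def
  proof (intro allI impI)
    fix i j k l assume *: "i < j \<and> j < k \<and> k < l \<and> l < length ?R"
    consider "l < ?n" | "\<not> l < ?n" "k < ?n" | "\<not> k < ?n" "j < ?n" | "\<not> j < ?n" "i < ?n" | "\<not> i < ?n" by blast
    then show "crossing {?R ! i, ?R ! k} {?R ! j, ?R ! l}"
    proof cases
      case 1
      then show ?thesis using * xs by (auto intro!: crossingI)
    next
      case 2
      then have "crossing {?R ! l, ?R ! j} {?R ! i, ?R ! k}"
        using * xs yx by (auto intro!: crossingI)
      then show ?thesis by (simp add: insert_commute crossing_commute)
    next
      case 3
      then have "crossing {?R ! k, ?R ! i} {?R ! l, ?R ! j}"
        using * xs ys yx by (auto intro!: crossingI)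
      then show ?thesis by (simp add: insert_commute crossing_commute)
    next
      case 4
      then have "crossing {?R ! j, ?R ! l} {?R ! k, ?R ! i}"
        using * ys yx by (auto intro!: crossingI)
      then show ?thesis by (simp add: insert_commute crossing_commute)
    next
      case 5
      then show ?thesis using * ys by (auto intro!: crossingI)
    qed
  qed
qed

text \<open>Choose the start \<open>s\<close>, then peel the arc of the other
  \<open>card B - 1\<close> points, which leaves at most \<open>2 ^ (card B - 2)\<close>
  continuations. For a single point truncated subtraction gives the correct exponent 0.\<close>

lemma card_ham_paths:
  fixes B :: "'a::linorder set"
  assumes "finite B"
  shows "finite (ham_paths B)"
    and "B \<noteq> {} \<Longrightarrow> card (ham_paths B) \<le> card B * 2 ^ (card B - 2)"
proof -
  define R where "R s = sorted_list_of_set {x\<in>B. s < x} @ sorted_list_of_set {x\<in>B. x < s}" for s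
  have fin: "finite {x\<in>B. s < x}" "finite {x\<in>B. x < s}" for s
    using assms by auto
  have R: "cyclic_from s (R s)" "cyclic_list (R s)" "distinct (R s)" "set (R s) = B - {s}" for s
    unfolding R_def using fin
    by (auto intro!: cyclic_rotated[where s = s])
  have sub: "ham_paths B \<subseteq> (if B = {} then {[]} else (\<Union>s\<in>B. (#) s ` peelings (R s)))"
  proof
    fix p assume p: "p \<in> ham_paths B"
    show "p \<in> (if B = {} then {[]} else (\<Union>s\<in>B. (#) s ` peelings (R s)))"
    proof (cases p)
      case Nil
      then show ?thesis using p by (auto simp: ham_paths_def)
    next
      case (Cons s q)
      have "q \<in> peelings (R s)"
        using p R[of s] unfolding Cons ham_paths_def by (intro path_in_peelings[of s]) auto
      then show ?thesis using p Cons by (auto simp: ham_paths_def)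
    qed
  qed
  have finU: "finite (\<Union>s\<in>B. (#) s ` peelings (R s))"
    using assms card_peelings by auto
  then show "finite (ham_paths B)"
    using finite_subset[OF sub] by (auto split: if_splits)
  assume "B \<noteq> {}"
  then have "card (ham_paths B) \<le> card (\<Union>s\<in>B. (#) s ` peelings (R s))"
    using sub finU by (auto intro: card_mono)
  also have "\<dots> \<le> (\<Sum>s\<in>B. card ((#) s ` peelings (R s)))"
    using assms by (rule card_UN_le)
  also have "\<dots> \<le> (\<Sum>s\<in>B. 2 ^ (card B - 2))"
  proof (rule sum_mono)
    fix s assume "s \<in> B"
    have "length (R s) = card B - 1"
      using R[of s] assms \<open>s \<in> B\<close> by (metis card_Diff_singleton distinct_card)
    then have "card (peelings (R s)) \<le> 2 ^ (card B - 2)"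
      using card_peelings[of "R s"] by (simp add: numeral_2_eq_2)
    then show "card ((#) s ` peelings (R s)) \<le> 2 ^ (card B - 2)"
      using card_peelings by (intro order.trans[OF card_image_le]) auto
  qed
  finally show "card (ham_paths B) \<le> card B * 2 ^ (card B - 2)" by simp
qed

text \<open>Every fibre contains both \<open>x\<close> and \<open>r x\<close>. With
  \<open>r = rev\<close> this accounts for the two directions in which a path can be listed.\<close>

lemma card_image_le_half:
  assumes "finite A" "\<And>x. x \<in> A \<Longrightarrow> r x \<in> A \<and> r x \<noteq> x \<and> f (r x) = f x"
  shows "2 * card (f ` A) \<le> card A"
proof -
  have "2 \<le> card {x\<in>A. f x = y}" if "y \<in> f ` A" for y
  proof -
    from that obtain x where x: "x \<in> A" "f x = y" by blast
    then have "{x, r x} \<subseteq> {x\<in>A. f x = y}" "card {x, r x} = 2"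
      using assms(2)[of x] by auto
    then show ?thesis using assms(1) by (metis card_mono finite_Collect_conjI finite_subset mem_Collect_eq subsetI)
  qed
  then have "(\<Sum>y\<in>f ` A. 2) \<le> (\<Sum>y\<in>f ` A. card {x\<in>A. f x = y})"
    by (rule sum_mono)
  also have "\<dots> = card A"
    using sum.image_gen[OF assms(1), of "\<lambda>_. 1::nat" f] by simp
  finally show ?thesis by simp
qed

text \<open>The formula \<open>m * 2 ^ (m - 3)\<close> for m >= 2, written so that it also makes
  sense at m = 1, where it gives 1/4; the correction 3/4 raises this to the one trivial path. In
  this shape the generating series has a simple closed form.\<close>

definition path_weight :: "nat \<Rightarrow> real" where
  "path_weight m = real m * 2 ^ m / 8 + (if m = 1 then 3 / 4 else 0)"

lemma card_path_edge_sets: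
  fixes B :: "'a::linorder set"
  assumes "finite B" "B \<noteq> {}"
  shows "real (card (path_edges ` ham_paths B)) \<le> path_weight (card B)"
proof (cases "card B = 1")
  case True
  have "real (card (path_edges ` ham_paths B)) \<le> real (card (ham_paths B))"
    using card_ham_paths(1)[OF assms(1)] card_image_le by auto
  also have "\<dots> \<le> 1"
    using card_ham_paths(2)[OF assms] True by simp
  finally show ?thesis using True by (simp add: path_weight_def)
next
  case False
  moreover have "card B \<noteq> 0" using assms by simp
  ultimately have c: "card B \<ge> 2" by linarith
  have "2 * card (path_edges ` ham_paths B) \<le> card (ham_paths B)"
  proof (rule card_image_le_half[where r = rev])
    fix p assume p: "p \<in> ham_paths B"
    then have "length p \<ge> 2" "distinct p"
      using c by (auto simp: ham_paths_def distinct_card)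
    then have "rev p \<noteq> p"
      using hd_neq_last hd_rev by metis
    then show "rev p \<in> ham_paths B \<and> rev p \<noteq> p \<and> path_edges (rev p) = path_edges p"
      using p by (auto simp: ham_paths_def path_edges_rev)
  qed (use card_ham_paths assms in auto)
  also have "\<dots> \<le> card B * 2 ^ (card B - 2)"
    using card_ham_paths assms by auto
  finally have "real (2 * card (path_edges ` ham_paths B)) \<le> real (card B * 2 ^ (card B - 2))"
    by (rule of_nat_mono)
  moreover have "(2::real) ^ card B = 4 * 2 ^ (card B - 2)"
    using c by (subst power_diff) auto
  ultimately show ?thesis
    using c by (simp add: path_weight_def)
qed

subsection \<open>Crossing-free path systems\<close>

text \<open>Taking the supremum over all sets of size \<open>n\<close> avoids showing that the
  number of forests depends on the size alone; an upper bound is all that is wanted.\<close>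

definition forest_count :: "nat \<Rightarrow> nat" where
  "forest_count n = (SUP S\<in>{S::real set. finite S \<and> card S = n}. card (forests S))"

lemma card_forests_le:
  fixes S :: "real set"
  assumes "finite S"
  shows "card (forests S) \<le> forest_count (card S)"
  unfolding forest_count_def
proof (rule cSUP_upper)
  show "bdd_above ((\<lambda>S. card (forests S)) ` {T::real set. finite T \<and> card T = card S})"
    using finite_forests(2) by (intro bdd_aboveI[of _ "2 ^ 2 ^ card S"]) fastforce
qed (use assms in simp)

lemma forest_count_le:
  assumes "\<And>S::real set. finite S \<Longrightarrow> card S = n \<Longrightarrow> card (forests S) \<le> c"
  shows "forest_count n \<le> c"
  unfolding forest_count_def
proof (rule cSUP_least)
  have "(real ` {..<n}) \<in> {S::real set. finite S \<and> card S = n}"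
    by (simp add: card_image)
  then show "{S::real set. finite S \<and> card S = n} \<noteq> {}" by blast
qed (use assms in auto)

section \<open>Decomposing a forest along the path through the minimum\<close>

definition splits :: "'a::linorder set \<Rightarrow> ('a set \<times> 'a set) set" where
  "splits T = {(S1, S2). S1 \<union> S2 = T \<and> (\<forall>x\<in>S1. \<forall>y\<in>S2. x < y)}"

lemma finite_splits: "finite T \<Longrightarrow> finite (splits T)"
  by (rule finite_subset[of _ "Pow T \<times> Pow T"]) (auto simp: splits_def)

lemma splits_disjoint: "(S1, S2) \<in> splits T \<Longrightarrow> S1 \<inter> S2 = {}"
  unfolding splits_def by fastforce

text \<open>First components are initial segments of \<open>T\<close>, hence comparable by
  inclusion, hence determined by their size. This turns sums over splits into sums over
  sizes.\<close>

lemma inj_on_card_splits: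
  assumes "finite T"
  shows "inj_on (\<lambda>x. card (fst x)) (splits T)"
proof (rule inj_onI, clarify)
  fix A B C D
  assume s: "(A, B) \<in> splits T" "(C, D) \<in> splits T" and c: "card (fst (A, B)) = card (fst (C, D))"
  have fin: "finite A" "finite C"
    using s assms unfolding splits_def by (auto intro: finite_subset)
  have "A \<subseteq> C \<or> C \<subseteq> A"
    using s unfolding splits_def by (auto; metis Un_iff less_asym)
  then have "A = C"
    using fin c by (metis card_subset_eq fst_conv)
  moreover have "B = T - A" "D = T - C"
    using s splits_disjoint[OF s(1)] splits_disjoint[OF s(2)] by (auto simp: splits_def)
  ultimately show "A = C \<and> B = D" by simp
qed

text \<open>Pairs \<open>(B, E)\<close> of an \<open>m\<close>-element block \<open>B\<close> containing \<open>Min S\<close> and a forest \<open>E\<close> on \<open>S - B\<close>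
  none of whose edges jumps over a point of \<open>B\<close>; the recursion peels off the first gap of the block.\<close>
primrec block_forests :: "nat \<Rightarrow> 'a::linorder set \<Rightarrow> ('a set \<times> 'a set set) set" where
  "block_forests 0 S = (if S = {} then {({}, {})} else {})"
| "block_forests (Suc m) S = (if S = {} then {} else
     (\<Union>(S1, S2)\<in>splits (S - {Min S}).
        (\<lambda>(E1, B, E2). (insert (Min S) B, E1 \<union> E2)) ` (forests S1 \<times> block_forests m S2)))"

text \<open>With F the generating function of \<open>forest_count\<close>, this is the coefficient
  of z^n in (z F(z))^m: each of the \<open>m\<close> block points is followed by a gap carrying an
  arbitrary forest.\<close>

primrec gap_sum :: "nat \<Rightarrow> nat \<Rightarrow> nat" where
  "gap_sum 0 n = (if n = 0 then 1 else 0)"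
| "gap_sum (Suc m) n = (\<Sum>k<n. forest_count k * gap_sum m (n - 1 - k))"

lemma block_forests_block:
  "finite S \<Longrightarrow> (B, E) \<in> block_forests m S \<Longrightarrow> B \<subseteq> S \<and> card B = m"
proof (induction m arbitrary: S B E)
  case (Suc m)
  then obtain S1 S2 B' E1 E2 where *: "S \<noteq> {}" "(S1, S2) \<in> splits (S - {Min S})"
    "(B', E2) \<in> block_forests m S2" "B = insert (Min S) B'"
    by (auto split: if_splits)
  then have "S2 \<subseteq> S - {Min S}" by (auto simp: splits_def)
  moreover from this have "B' \<subseteq> S2 \<and> card B' = m"
    using Suc.IH[OF _ *(3)] Suc.prems(1) by (meson finite_Diff finite_subset)
  ultimately have "B' \<subseteq> S - {Min S}" "card B' = m" by auto
  moreover have "finite B'" using calculation Suc.prems(1) by (meson finite_Diff finite_subset)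
  ultimately show ?case
    using * Suc.prems(1) by (auto simp: card_insert_if)
qed (auto split: if_splits)

text \<open>Union bound along the recursion of \<open>block_forests\<close>. Splits are told apart
  by the size \<open>k\<close> of the first gap, so the sum over splits is at most the sum over
  \<open>k\<close>.\<close>

lemma card_block_forests:
  fixes S :: "real set"
  assumes "finite S"
  shows "finite (block_forests m S) \<and> card (block_forests m S) \<le> gap_sum m (card S)"
  using assms
proof (induction m arbitrary: S)
  case (Suc m)
  show ?case
  proof (cases "S = {}")
    case False
    define T where "T = S - {Min S}"
    define g where "g k = forest_count k * gap_sum m (card S - 1 - k)" for k
    define h where "h = (\<lambda>(S1, S2). (\<lambda>(E1, B, E2). (insert (Min S) B, E1 \<union> E2)) ` (forests S1 \<times> block_forests m S2))"
    have T: "finite T" "card T = card S - 1" "card S > 0"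
      using Suc.prems False by (auto simp: T_def card_gt_0_iff)
    have eq: "block_forests (Suc m) S = (\<Union>x\<in>splits T. h x)"
      using False by (simp add: T_def h_def)
    have *: "finite (h x) \<and> card (h x) \<le> g (card (fst x)) \<and> card (fst x) < card S" if "x \<in> splits T" for x
    proof -
      obtain S1 S2 where x: "x = (S1, S2)" by force
      have fin: "finite S1" "finite S2" "S1 \<union> S2 = T"
        using that T x by (auto simp: splits_def)
      then have "card S1 + card S2 = card T"
        using splits_disjoint that x by (metis card_Un_disjoint)
      then have c: "card S2 = card S - 1 - card S1" "card S1 < card S"
        using T by auto
      have fin': "finite (forests S1 \<times> block_forests m S2)"
        using fin Suc.IH finite_forests by auto
      have "card (h x) \<le> card (forests S1 \<times> block_forests m S2)"
        unfolding h_def x using fin' by (simp add: card_image_le)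
      also have "\<dots> \<le> forest_count (card S1) * gap_sum m (card S2)"
        unfolding card_cartesian_product using fin Suc.IH by (intro mult_mono card_forests_le) auto
      finally show ?thesis
        using c fin' by (simp add: x g_def h_def)
    qed
    have "card (\<Union>x\<in>splits T. h x) \<le> (\<Sum>x\<in>splits T. card (h x))"
      using T finite_splits by (intro card_UN_le) auto
    also have "\<dots> \<le> (\<Sum>x\<in>splits T. g (card (fst x)))"
      using * by (intro sum_mono) auto
    also have "\<dots> = (\<Sum>k\<in>(\<lambda>x. card (fst x)) ` splits T. g k)"
      using inj_on_card_splits[OF T(1)] by (simp add: sum.reindex)
    also have "\<dots> \<le> (\<Sum>k<card S. g k)"
      using * by (intro sum_mono2) auto
    finally have "card (block_forests (Suc m) S) \<le> gap_sum (Suc m) (card S)"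
      unfolding eq g_def gap_sum.simps .
    moreover have "finite (block_forests (Suc m) S)"
      unfolding eq using * finite_splits[OF T(1)] by blast
    ultimately show ?thesis by blast
  qed simp
qed simp

lemma path_system_empty: "path_system P {} \<Longrightarrow> system_edges P = {}"
  by (auto simp: path_system_def system_edges_def)

lemma path_system_restrict:
  assumes "path_system P S" "X \<subseteq> S" "\<And>q. q \<in> P \<Longrightarrow> set q \<subseteq> X \<or> set q \<inter> X = {}"
  shows "path_system {q\<in>P. set q \<subseteq> X} X"
proof -
  have "x \<in> \<Union> (set ` {q\<in>P. set q \<subseteq> X})" if "x \<in> X" for x
  proof -
    from that assms(1,2) obtain q where "q \<in> P" "x \<in> set q"
      by (auto simp: path_system_def)
    then show ?thesis using assms(3)[of q] that by auto
  qed
  then have "\<Union> (set ` {q\<in>P. set q \<subseteq> X}) = X" by auto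
  then show ?thesis
    using assms(1) by (simp add: path_system_def)
qed

text \<open>Completeness of the recursion. A path on one side of every block point lies within a
  single gap, so cutting in front of the second block point distributes the paths over the two
  parts.\<close>

lemma block_forestsI:
  assumes "finite S" "B \<subseteq> S" "card B = m" "S \<noteq> {} \<Longrightarrow> Min S \<in> B" "path_system P (S - B)"
    "crossing_free (system_edges P)"
    "\<And>q b. q \<in> P \<Longrightarrow> b \<in> B \<Longrightarrow> (\<forall>x\<in>set q. x < b) \<or> (\<forall>x\<in>set q. b < x)"
  shows "(B, system_edges P) \<in> block_forests m S"
  using assms
proof (induction m arbitrary: S B P)
  case 0
  then have "B = {}" by (metis card_0_eq finite_subset)
  then have "S = {}" using 0 by auto
  moreover have "system_edges P = {}"
    using 0(5) \<open>S = {}\<close> path_system_empty by simp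
  ultimately show ?case using \<open>B = {}\<close> by simp
next
  case (Suc m)
  define s where "s = Min S"
  have "S \<noteq> {}" using Suc.prems by auto
  then have s: "s \<in> B" "\<And>x. x \<in> S \<Longrightarrow> s \<le> x"
    using Suc.prems by (auto simp: s_def)
  \<comment> \<open>\<open>S2\<close> starts at the second smallest point of \<open>B\<close> and
    \<open>S1\<close> is the gap before it. If \<open>B\<close> is just \<open>{s}\<close>, then
    \<open>S2\<close> is empty and \<open>S1\<close> is all the rest.\<close>
  define S2 where "S2 = {y\<in>S. \<exists>b\<in>B - {s}. b \<le> y}"
  define S1 where "S1 = S - {s} - S2"
  define P1 where "P1 = {q\<in>P. set q \<subseteq> S1}"
  define P2 where "P2 = {q\<in>P. set q \<subseteq> S2}"
  have s2: "s \<notin> S2"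
  proof
    assume "s \<in> S2"
    then obtain b where "b \<in> B - {s}" "b \<le> s" by (auto simp: S2_def)
    then show False using s(2)[of b] Suc.prems(2) by auto
  qed
  have split: "(S1, S2) \<in> splits (S - {s})"
    unfolding splits_def
  proof (clarify, intro conjI ballI)
    show "S1 \<union> S2 = S - {s}" using s2 by (auto simp: S1_def S2_def)
    fix x y assume x: "x \<in> S1" and "y \<in> S2"
    then obtain b where "b \<in> B - {s}" "b \<le> y" by (auto simp: S2_def)
    moreover from this x have "\<not> b \<le> x" by (auto simp: S1_def S2_def)
    ultimately show "x < y" by simp
  qed
  have q: "set q \<subseteq> S1 \<or> set q \<subseteq> S2" if "q \<in> P" for q
  proof (cases "\<exists>b\<in>B - {s}. \<forall>x\<in>set q. b < x")
    case True
    have "set q \<subseteq> S" using that Suc.prems(5) by (auto simp: path_system_def)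
    then show ?thesis using True by (auto simp: S2_def intro: less_imp_le)
  next
    case False
    then have "x < b" if "x \<in> set q" "b \<in> B - {s}" for x b
      using Suc.prems(7)[OF \<open>q \<in> P\<close>, of b] that by blast
    moreover have "set q \<subseteq> S - {s}" using \<open>q \<in> P\<close> s Suc.prems(5) by (auto simp: path_system_def)
    ultimately have "set q \<subseteq> S1" by (fastforce simp: S1_def S2_def)
    then show ?thesis by simp
  qed
  have sub: "S1 \<subseteq> S - B" "S2 - (B - {s}) \<subseteq> S - B"
    using Suc.prems(2) s2 by (auto simp: S1_def S2_def)
  have disj: "S1 \<inter> S2 = {}" by (auto simp: S1_def)
  have edges: "system_edges P = system_edges P1 \<union> system_edges P2"
  proof -
    have "P = P1 \<union> P2" using q by (auto simp: P1_def P2_def)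
    then show ?thesis by (auto simp: system_edges_def)
  qed
  have "path_system P1 S1"
    unfolding P1_def using q disj by (intro path_system_restrict[OF Suc.prems(5) sub(1)]) blast
  then have 1: "system_edges P1 \<in> forests S1"
    using Suc.prems(6) edges crossing_free_subset by (auto simp: forests_def)
  have "path_system {q\<in>P. set q \<subseteq> S2 - (B - {s})} (S2 - (B - {s}))"
  proof (rule path_system_restrict[OF Suc.prems(5) sub(2)])
    fix r assume "r \<in> P"
    then have "set r \<subseteq> S - B" using Suc.prems(5) by (auto simp: path_system_def)
    then show "set r \<subseteq> S2 - (B - {s}) \<or> set r \<inter> (S2 - (B - {s})) = {}"
      using q[OF \<open>r \<in> P\<close>] disj by blast
  qed
  also have "{q\<in>P. set q \<subseteq> S2 - (B - {s})} = P2"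
    using Suc.prems(5) by (auto simp: P2_def path_system_def)
  finally have "(B - {s}, system_edges P2) \<in> block_forests m S2"
  proof (rule Suc.IH[rotated 4])
    show "finite S2" using Suc.prems(1) by (simp add: S2_def)
    show "B - {s} \<subseteq> S2" using Suc.prems(2) by (auto simp: S2_def)
    show "card (B - {s}) = m" using Suc.prems(3) s by simp
    show "crossing_free (system_edges P2)"
      using Suc.prems(6) edges crossing_free_subset by auto
    show "(\<forall>x\<in>set q. x < b) \<or> (\<forall>x\<in>set q. b < x)" if "q \<in> P2" "b \<in> B - {s}" for q b
      using Suc.prems(7) that by (auto simp: P2_def)
    \<comment> \<open>Every point of \<open>S2\<close> lies above or at a block point in
      \<open>S2\<close>, so its minimum is a block point, as the induction hypothesis asks.\<close>
    assume "S2 \<noteq> {}"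
    then have "Min S2 \<in> S2" using \<open>finite S2\<close> by simp
    then obtain b where b: "b \<in> B - {s}" "b \<le> Min S2" by (auto simp: S2_def)
    then have "Min S2 \<le> b" using \<open>finite S2\<close> \<open>B - {s} \<subseteq> S2\<close> by (meson Min_le subsetD)
    then show "Min S2 \<in> B - {s}" using b by (metis antisym)
  qed
  with 1 have "(insert s (B - {s}), system_edges P1 \<union> system_edges P2) \<in>
      (\<lambda>(E1, B, E2). (insert (Min S) B, E1 \<union> E2)) ` (forests S1 \<times> block_forests m S2)"
    unfolding s_def by (auto intro!: image_eqI[of _ _ "(system_edges P1, B - {Min S}, system_edges P2)"])
  then have "(B, system_edges P) \<in>
      (\<lambda>(E1, B, E2). (insert (Min S) B, E1 \<union> E2)) ` (forests S1 \<times> block_forests m S2)"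
    using s(1) by (simp only: insert_Diff edges)
  then have "\<exists>x\<in>splits (S - {Min S}). (B, system_edges P) \<in> (case x of (S1, S2) \<Rightarrow>
      (\<lambda>(E1, B, E2). (insert (Min S) B, E1 \<union> E2)) ` (forests S1 \<times> block_forests m S2))"
    using split unfolding s_def by (intro bexI[of _ "(S1, S2)"]) simp_all
  then show ?case
    using \<open>S \<noteq> {}\<close> by (simp only: block_forests.simps if_False UN_iff)
qed

text \<open>If \<open>q\<close> had points on both sides of \<open>b\<close>, one of its edges
  \<open>{u, v}\<close> would enclose \<open>b\<close>. Since \<open>s\<close> is below all of
  \<open>q\<close>, the path \<open>p\<close> gets from \<open>b\<close> out of the interval between
  \<open>u\<close> and \<open>v\<close>, and the edge on which it does so crosses
  \<open>{u, v}\<close>.\<close>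

lemma path_same_side:
  assumes "distinct p" "distinct q" "set p \<inter> set q = {}" "crossing_free (path_edges p \<union> path_edges q)"
    "s \<in> set p" "\<And>x. x \<in> set q \<Longrightarrow> s < x" "b \<in> set p"
  shows "(\<forall>x\<in>set q. x < b) \<or> (\<forall>x\<in>set q. b < x)"
proof (rule ccontr)
  assume "\<not> ?thesis"
  then obtain x y where "x \<in> set q" "y \<in> set q" "x < b" "\<not> y < b"
    using assms(3,7) by (metis disjoint_iff linorder_neqE)
  then obtain u v where uv: "{u, v} \<in> path_edges q" "u \<in> set q" "v \<in> set q" "u < b" "\<not> v < b"
    using path_edges_change[of x q y "\<lambda>x. x < b"] by blast
  have "b < v" using uv assms(3,7) by (metis disjoint_iff linorder_neqE)
  moreover have "\<not> (u < s \<and> s < v)" using uv assms(6) by (meson less_asym)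
  ultimately obtain c d where cd: "{c, d} \<in> path_edges p" "c \<in> set p" "d \<in> set p"
      "u < c" "c < v" "\<not> (u < d \<and> d < v)"
    using path_edges_change[of b p s "\<lambda>x. u < x \<and> x < v"] assms(5,7) uv(4) by blast
  then have "d < u \<or> v < d"
    using uv assms(3) by (metis disjoint_iff linorder_neqE)
  then have "crossing {c, d} {u, v}"
    using cd crossingI[of d u c v] crossingI[of u c v d]
    by (auto simp: insert_commute crossing_commute)
  then show False
    using assms(4) cd uv unfolding crossing_free_def by blast
qed

text \<open>The path through \<open>Min S\<close> supplies the block; \<open>path_same_side\<close>
  confines every other path to one gap.\<close>

lemma forests_decompose:
  assumes "finite S" "S \<noteq> {}" "E \<in> forests S"
  shows "\<exists>m\<in>{1..card S}. \<exists>(B, E')\<in>block_forests m S. E \<in> (\<lambda>H. H \<union> E') ` path_edges ` ham_paths B"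
proof -
  obtain P where P: "path_system P S" "crossing_free (system_edges P)" "E = system_edges P"
    using assms by (auto simp: forests_def)
  have "Min S \<in> S" using assms by simp
  then obtain p where p: "p \<in> P" "Min S \<in> set p"
    using P by (auto simp: path_system_def)
  have E: "E = path_edges p \<union> system_edges (P - {p})"
    using P p by (auto simp: system_edges_def)
  have ps: "path_system (P - {p}) (S - set p)"
    using P(1) p(1) unfolding path_system_def by blast
  have "set p \<subseteq> S" using P p by (auto simp: path_system_def)
  then have card: "card (set p) \<in> {1..card S}"
    using p assms card_mono[of S "set p"] by (auto simp: Suc_le_eq card_gt_0_iff)
  have "(set p, system_edges (P - {p})) \<in> block_forests (card (set p)) S"
  proof (rule block_forestsI[OF assms(1) \<open>set p \<subseteq> S\<close> refl p(2) ps])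
    show "crossing_free (system_edges (P - {p}))"
      using P(2,3) E crossing_free_subset by auto
    fix q b assume q: "q \<in> P - {p}" and b: "b \<in> set p"
    show "(\<forall>x\<in>set q. x < b) \<or> (\<forall>x\<in>set q. b < x)"
    proof (rule path_same_side[OF _ _ _ _ p(2) _ b])
      show "distinct p" "distinct q" "set p \<inter> set q = {}"
        using P(1) p(1) q by (auto simp: path_system_def)
      show "crossing_free (path_edges p \<union> path_edges q)"
        using P(2) p(1) q by (auto simp: system_edges_def intro: crossing_free_subset)
      show "Min S < x" if "x \<in> set q" for x
      proof -
        have "x \<in> S - set p" using ps q that by (auto simp: path_system_def)
        then show ?thesis
          using p(2) assms by (metis DiffD1 DiffD2 Min_le order_le_less)
      qed
    qed
  qed
  moreover have "p \<in> ham_paths (set p)"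
    using P p E by (auto simp: ham_paths_def path_system_def intro: crossing_free_subset)
  ultimately show ?thesis
    using card E by (intro bexI[OF _ card]) auto
qed

lemma forest_count_0: "forest_count 0 \<le> 1"
proof (rule forest_count_le)
  fix S :: "real set" assume "finite S" "card S = 0"
  then have "forests S \<subseteq> {{}}"
    using path_system_empty by (auto simp: forests_def)
  then show "card (forests S) \<le> 1"
    using card_mono[of "{{}}" "forests S"] by simp
qed

text \<open>Union bound over the block size, the block with the forest in its gaps, and the path
  drawn on the block.\<close>

lemma forest_count_rec:
  assumes "n > 0"
  shows "real (forest_count n) \<le> (\<Sum>m=1..n. path_weight m * real (gap_sum m n))"
proof -
  define c where "c = (\<Sum>m=1..n. path_weight m * real (gap_sum m n))"
  have w: "path_weight m \<ge> 0" for m by (simp add: path_weight_def)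
  \<comment> \<open>The supremum is compared with a natural number, so the real bound is rounded
    down first.\<close>
  have "card (forests S) \<le> nat \<lfloor>c\<rfloor>" if S: "finite S" "card S = n" for S :: "real set"
  proof -
    define H where "H = (\<lambda>(B, E'). (\<lambda>H. H \<union> E') ` path_edges ` ham_paths (B::real set))"
    have sub: "forests S \<subseteq> (\<Union>m\<in>{1..n}. \<Union>x\<in>block_forests m S. H x)"
      using forests_decompose[of S] S assms by (fastforce simp: H_def)
    have H: "finite (H x) \<and> real (card (H x)) \<le> path_weight m"
      if "m \<in> {1..n}" "x \<in> block_forests m S" for m x
    proof -
      obtain B E' where x: "x = (B, E')" by force
      then have B: "card B = m" "B \<subseteq> S" "finite B" "B \<noteq> {}"
        using block_forests_block[OF S(1), of B E' m] that S(1) by (auto dest: finite_subset)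
      then have fin: "finite (path_edges ` ham_paths B)"
        using card_ham_paths(1) by auto
      then have "real (card (H x)) \<le> real (card (path_edges ` ham_paths B))"
        using card_image_le by (auto simp: H_def x)
      also have "\<dots> \<le> path_weight m"
        using card_path_edge_sets B by auto
      finally show ?thesis using fin by (simp add: H_def x)
    qed
    have fin: "finite (block_forests m S)" for m
      using card_block_forests S by auto
    have "real (card (forests S)) \<le> real (card (\<Union>m\<in>{1..n}. \<Union>x\<in>block_forests m S. H x))"
      using sub fin H by (intro of_nat_mono card_mono) auto
    also have "\<dots> \<le> real (\<Sum>m=1..n. \<Sum>x\<in>block_forests m S. card (H x))"
      using fin by (intro of_nat_mono order.trans[OF card_UN_le] sum_mono card_UN_le) auto
    also have "\<dots> = (\<Sum>m=1..n. \<Sum>x\<in>block_forests m S. real (card (H x)))"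
      by simp
    also have "\<dots> \<le> (\<Sum>m=1..n. \<Sum>x\<in>block_forests m S. path_weight m)"
      using H by (intro sum_mono) blast
    also have "\<dots> \<le> c"
      unfolding c_def using card_block_forests S w
      by (intro sum_mono) (auto simp: mult.commute intro!: mult_left_mono)
    finally show ?thesis by linarith
  qed
  then have "forest_count n \<le> nat \<lfloor>c\<rfloor>"
    by (rule forest_count_le)
  moreover have "c \<ge> 0" unfolding c_def using w by (intro sum_nonneg) auto
  ultimately show ?thesis unfolding c_def by linarith
qed

section \<open>Generating function estimates with truncated sums\<close>

lemma convolution_le:
  fixes a b :: "nat \<Rightarrow> real"
  assumes "\<And>i. a i \<ge> 0" "\<And>i. b i \<ge> 0"
  shows "(\<Sum>n<Suc M. \<Sum>k<n. a k * b (n - 1 - k)) \<le> (\<Sum>k<M. a k) * (\<Sum>j<Suc M. b j)"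
proof -
  \<comment> \<open>The summand for n = 0 is empty, and shifting by one absorbs the
    \<open>n - 1\<close>. What remains is a sum over a triangle of index pairs, which is then
    enlarged to a rectangle of nonnegative terms.\<close>
  have "(\<Sum>n<Suc M. \<Sum>k<n. a k * b (n - 1 - k)) = (\<Sum>n<M. \<Sum>k\<le>n. a k * b (n - k))"
    by (subst sum.lessThan_Suc_shift) (simp add: lessThan_Suc_atMost)
  also have "\<dots> = (\<Sum>(i, j)\<in>{(i, j). i + j < M}. a i * b j)"
    by (rule sum.triangle_reindex[symmetric])
  also have "\<dots> \<le> (\<Sum>(i, j)\<in>{..<M} \<times> {..<Suc M}. a i * b j)"
    using assms by (intro sum_mono2) auto
  finally show ?thesis by (simp only: sum_product sum.cartesian_product)
qed

text \<open>Truncated form of the coefficient identity. Every block point uses up one factor z, so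
  coefficients up to \<open>M\<close> involve forests on fewer than \<open>M\<close> points; this
  gain of one drives the induction in \<open>forest_count_generating\<close>.\<close>

lemma gap_sum_generating:
  fixes z :: real
  assumes "z \<ge> 0"
  shows "(\<Sum>n<Suc M. gap_sum m n * z ^ n) \<le> (z * (\<Sum>k<M. forest_count k * z ^ k)) ^ m"
proof (induction m)
  case 0
  have "(\<Sum>n<Suc M. gap_sum 0 n * z ^ n) = (\<Sum>n<Suc M. if n = 0 then 1 else 0)"
    by (intro sum.cong) auto
  then show ?case by (simp add: sum.delta)
next
  case (Suc m)
  let ?a = "\<lambda>k. forest_count k * z ^ k" and ?b = "\<lambda>j. gap_sum m j * z ^ j"
  have "(\<Sum>n<Suc M. gap_sum (Suc m) n * z ^ n) = (\<Sum>n<Suc M. \<Sum>k<n. z * (?a k * ?b (n - 1 - k)))"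
  proof (intro sum.cong refl)
    fix n
    have "z ^ n = z * (z ^ k * z ^ (n - 1 - k))" if "k < n" for k
      using that by (simp flip: power_add power_Suc)
    then show "gap_sum (Suc m) n * z ^ n = (\<Sum>k<n. z * (?a k * ?b (n - 1 - k)))"
      by (simp add: sum_distrib_right) (intro sum.cong, auto)
  qed
  also have "\<dots> = z * (\<Sum>n<Suc M. \<Sum>k<n. ?a k * ?b (n - 1 - k))"
    by (simp only: sum_distrib_left)
  also have "\<dots> \<le> z * ((\<Sum>k<M. ?a k) * (\<Sum>j<Suc M. ?b j))"
    using assms by (intro mult_left_mono convolution_le) auto
  also have "\<dots> \<le> z * ((\<Sum>k<M. ?a k) * (z * (\<Sum>k<M. ?a k)) ^ m)"
    using assms Suc by (intro mult_left_mono sum_nonneg) auto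
  finally show ?case by (simp add: algebra_simps)
qed

lemma sum_index_power_le:
  fixes y :: real
  assumes "0 \<le> y" "y < 1"
  shows "(\<Sum>m=1..M. m * y ^ m) \<le> y / (1 - y)\<^sup>2"
proof -
  \<comment> \<open>Clearing the denominator makes the sum telescope, and the remainder has the
    favourable sign.\<close>
  have "(1 - y)\<^sup>2 * (\<Sum>m=1..M. m * y ^ m) = y - (M + 1) * y ^ (M + 1) + M * y ^ (M + 2)"
    by (induction M) (auto simp: algebra_simps power2_eq_square)
  also have "\<dots> \<le> y"
  proof -
    have "y ^ (M + 2) \<le> y ^ (M + 1)" using assms by (intro power_decreasing) auto
    then have "M * y ^ (M + 2) \<le> (M + 1) * y ^ (M + 1)"
      using assms by (intro mult_mono) auto
    then show ?thesis by simp
  qed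
  finally show ?thesis
    using assms by (simp add: field_simps)
qed

lemma path_weight_series_le:
  fixes t :: real
  assumes "0 \<le> t" "2 * t < 1"
  shows "(\<Sum>m=1..M. path_weight m * t ^ m) \<le> 3 * t / 4 + t / (4 * (1 - 2 * t)\<^sup>2)"
proof -
  have "(\<Sum>m=1..M. path_weight m * t ^ m) =
      (\<Sum>m=1..M. real m * (2 * t) ^ m) / 8 + (\<Sum>m=1..M. if m = 1 then 3 * t / 4 else 0)"
    unfolding sum_divide_distrib sum.distrib[symmetric]
    by (intro sum.cong) (auto simp: path_weight_def power_mult_distrib algebra_simps)
  also have "(\<Sum>m=1..M. if m = 1 then 3 * t / 4 else 0) \<le> 3 * t / 4"
    using assms by (simp add: sum.delta)
  also have "(\<Sum>m=1..M. real m * (2 * t) ^ m) / 8 \<le> (2 * t / (1 - 2 * t)\<^sup>2) / 8"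
    using assms sum_index_power_le[of "2 * t" M] by (intro divide_right_mono) auto
  finally show ?thesis by simp
qed

text \<open>The generating function \<open>F\<close> of noncrossing partitions whose blocks carry a path satisfies
  \<open>F(z) = \<phi>(z F(z))\<close> with \<open>\<phi>(t) = 1 + 3t/4 + t/(4(1-2t)\<^sup>2)\<close>, so its partial sums stay
  below \<open>\<phi>(t)\<close> at \<open>z = t/\<phi>(t)\<close>.\<close>
lemma forest_count_generating:
  fixes t K :: real
  assumes "0 < t" "2 * t < 1" "K = 1 + 3 * t / 4 + t / (4 * (1 - 2 * t)\<^sup>2)"
  shows "(\<Sum>n<M. forest_count n * (t / K) ^ n) \<le> K"
proof (induction M)
  have "0 \<le> t / (4 * (1 - 2 * t)\<^sup>2)"
    using assms(1) by (intro divide_nonneg_nonneg) auto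
  then have K: "K \<ge> 1" using assms(1,3) by linarith
  case 0
  show ?case using K by simp
next
  case (Suc M)
  define z where "z = t / K"
  have "0 \<le> t / (4 * (1 - 2 * t)\<^sup>2)"
    using assms(1) by (intro divide_nonneg_nonneg) auto
  then have K: "K \<ge> 1" using assms(1,3) by linarith
  then have z: "z > 0" "z * K = t" using assms(1) by (auto simp: z_def)
  have w: "path_weight m \<ge> 0" for m by (simp add: path_weight_def)
  have "(\<Sum>n<Suc M. forest_count n * z ^ n) = forest_count 0 + (\<Sum>n<M. forest_count (Suc n) * z ^ Suc n)"
    by (simp add: sum.lessThan_Suc_shift del: sum.lessThan_Suc)
  \<comment> \<open>Blocks in \<open>Suc n\<close> points have size at most \<open>Suc n\<close>,
    which is at most \<open>M\<close>, so a common range for \<open>m\<close> can be used and the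
    sums swapped afterwards.\<close>
  also have "\<dots> \<le> 1 + (\<Sum>n<M. (\<Sum>m=1..M. path_weight m * gap_sum m (Suc n)) * z ^ Suc n)"
  proof (intro add_mono sum_mono mult_right_mono)
    show "real (forest_count 0) \<le> 1" using forest_count_0 by simp
    fix n assume n: "n \<in> {..<M}"
    have "real (forest_count (Suc n)) \<le> (\<Sum>m=1..Suc n. path_weight m * gap_sum m (Suc n))"
      by (rule forest_count_rec) simp
    also have "\<dots> \<le> (\<Sum>m=1..M. path_weight m * gap_sum m (Suc n))"
      using n w by (intro sum_mono2) auto
    finally show "real (forest_count (Suc n)) \<le> (\<Sum>m=1..M. path_weight m * gap_sum m (Suc n))" .
  qed (use z in auto)
  also have "\<dots> \<le> 1 + (\<Sum>n<Suc M. (\<Sum>m=1..M. path_weight m * gap_sum m n) * z ^ n)"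
    using z w by (subst sum.lessThan_Suc_shift[of _ M]) (auto intro!: sum_nonneg mult_nonneg_nonneg)
  also have "\<dots> = 1 + (\<Sum>m=1..M. path_weight m * (\<Sum>n<Suc M. gap_sum m n * z ^ n))"
    unfolding sum_distrib_left sum_distrib_right
    by (subst sum.swap) (simp add: mult.assoc)
  also have "\<dots> \<le> 1 + (\<Sum>m=1..M. path_weight m * t ^ m)"
  proof (intro add_left_mono sum_mono mult_left_mono w)
    fix m
    have "(\<Sum>n<Suc M. gap_sum m n * z ^ n) \<le> (z * (\<Sum>k<M. forest_count k * z ^ k)) ^ m"
      using z by (intro gap_sum_generating) simp
    \<comment> \<open>The induction hypothesis enters here: the inner partial sum stops at
      \<open>M\<close> and is at most \<open>K\<close>, while \<open>z * K = t\<close>.\<close>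
    also have "\<dots> \<le> (z * K) ^ m"
      using z Suc by (intro power_mono mult_left_mono mult_nonneg_nonneg sum_nonneg) (auto simp: z_def)
    finally show "(\<Sum>n<Suc M. gap_sum m n * z ^ n) \<le> t ^ m" using z by simp
  qed
  also have "\<dots> \<le> K"
    using path_weight_series_le[of t M] assms by linarith
  finally show ?case unfolding z_def .
qed

lemma forest_count_bound: "\<exists>C::real. \<forall>n. forest_count n \<le> C * 5.610718614 ^ n"
proof -
  \<comment> \<open>A rational approximation to the minimiser of phi(t)/t, which solves (1 - 2t)^3 =
    t^2. Every admissible \<open>t\<close> gives a valid growth rate, so only the numerical
    inequality \<open>Kt\<close> has to be checked.\<close>
  define t :: real where "t = 14199 / 50000"
  define K where "K = 1 + 3 * t / 4 + t / (4 * (1 - 2 * t)\<^sup>2)"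
  have t: "0 < t" "2 * t < 1" by (auto simp: t_def)
  then have K: "K \<ge> 1" by (simp add: K_def)
  have Kt: "K / t \<le> 5.610718614"
    by (simp add: K_def t_def power2_eq_square)
  have "forest_count n \<le> K * 5.610718614 ^ n" for n
  proof -
    have "forest_count n * (t / K) ^ n \<le> (\<Sum>n<Suc n. forest_count n * (t / K) ^ n)"
      using t K by (intro member_le_sum) auto
    also have "\<dots> \<le> K"
      using t by (intro forest_count_generating) (auto simp: K_def)
    finally have "forest_count n \<le> K * (K / t) ^ n"
      using t K by (simp add: field_simps)
    also have "\<dots> \<le> K * 5.610718614 ^ n"
      using t K Kt by (intro mult_left_mono power_mono) auto
    finally show ?thesis .
  qed
  then show ?thesis by blast
qed

subsection \<open>Polygonizations of the double chain\<close>

lemma path_edges_conv_nth: "path_edges p = (\<lambda>i. {p ! i, p ! Suc i}) ` {..<length p - 1}"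
proof (induction p rule: path_edges.induct)
  case (1 x y r)
  have "{..<length (x # y # r) - 1} = insert 0 (Suc ` {..<length (y # r) - 1})"
    by (simp add: lessThan_Suc_eq_insert_0)
  then show ?case using 1 by (simp add: image_image)
qed auto

lemma cycle_edges_conv_path:
  assumes "vs \<noteq> []"
  shows "cycle_edges vs = insert {last vs, hd vs} (path_edges vs)"
proof -
  obtain n where n: "length vs = Suc n" using assms by (cases vs) auto
  have "cycle_edges vs = cyc_edge vs ` insert n {..<n}"
    by (simp add: cycle_edges_def n lessThan_Suc)
  also have "\<dots> = insert {last vs, hd vs} (path_edges vs)"
    using n assms by (auto simp: path_edges_conv_nth cyc_edge_def last_conv_nth hd_conv_nth)
  finally show ?thesis .
qed

lemma cycle_edges_rotate1: "cycle_edges (rotate1 vs) = cycle_edges vs"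
proof (cases vs)
  case (Cons x xs)
  then show ?thesis
    by (cases "xs = []")
      (auto simp: cycle_edges_conv_path path_edges_Cons path_edges_snoc insert_commute hd_append)
qed simp

lemma cycle_edges_rotate: "cycle_edges (rotate k vs) = cycle_edges vs"
  by (induction k) (simp_all add: cycle_edges_rotate1)

text \<open>Used to choose the first vertex conveniently: if \<open>v\<close> is off a chain, the
  closing edge is not inside that chain and the cycle may be treated as a path.\<close>

lemma ham_cycle_start_at:
  assumes "ham_cycle vs S" "v \<in> S"
  obtains ws where "ham_cycle (v # ws) S" "cycle_edges (v # ws) = cycle_edges vs"
proof -
  obtain xs ys where vs: "vs = xs @ v # ys"
    using assms by (auto simp: ham_cycle_def dest: split_list)
  have "rotate (length xs) vs = v # (ys @ xs)"
    by (simp add: vs rotate_append)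
  then have "cycle_edges (v # (ys @ xs)) = cycle_edges vs"
    by (metis cycle_edges_rotate)
  moreover have "ham_cycle (v # (ys @ xs)) S"
    using assms(1) by (auto simp: ham_cycle_def vs)
  ultimately show ?thesis using that by blast
qed

lemma cycle_degree:
  assumes "ham_cycle vs S" "v \<in> S"
  shows "card {e\<in>cycle_edges vs. v \<in> e} = 2"
proof -
  obtain ws where ws: "ham_cycle (v # ws) S" "cycle_edges (v # ws) = cycle_edges vs"
    using ham_cycle_start_at assms by blast
  then have d: "v \<notin> set ws" "distinct ws" "length ws \<ge> 2"
    by (auto simp: ham_cycle_def)
  then have "ws \<noteq> []" by auto
  \<comment> \<open>With at least three vertices the two neighbours of \<open>v\<close> differ, so
    its two edges are different sets.\<close>
  have ne: "hd ws \<noteq> last ws"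
    using d hd_neq_last by blast
  have "{e\<in>cycle_edges vs. v \<in> e} = {{last ws, v}, {v, hd ws}}"
    using d \<open>ws \<noteq> []\<close> path_edges_subset[of _ ws]
    by (auto simp: ws(2)[symmetric] cycle_edges_conv_path path_edges_Cons)
  moreover have "{last ws, v} \<noteq> {v, hd ws}"
    using ne by (auto simp: doubleton_eq_iff)
  ultimately show ?thesis by simp
qed

lemma cycle_edges_pair:
  assumes "ham_cycle vs S" "e \<in> cycle_edges vs"
  shows "\<exists>x y. e = {x, y} \<and> x \<noteq> y \<and> x \<in> S \<and> y \<in> S"
proof -
  have vs: "vs \<noteq> []" "distinct vs" "set vs = S" "length vs \<ge> 3"
    using assms(1) by (auto simp: ham_cycle_def)
  then have "last vs \<noteq> hd vs" using hd_neq_last[of vs] by fastforce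
  moreover have "last vs \<in> S" "hd vs \<in> S" using vs by auto
  moreover have "e = {last vs, hd vs} \<or> e \<in> path_edges vs"
    using assms(2) vs(1) by (simp add: cycle_edges_conv_path)
  ultimately show ?thesis
    using path_edges_pair[of e vs] vs(2,3) by blast
qed

text \<open>Deleting the vertices outside \<open>X\<close> cuts a path into pieces. The last
  conjunct strengthens the induction: to prepend a vertex, a piece starting at the old head must be
  available.\<close>

lemma path_edges_restrict:
  assumes "distinct xs"
  shows "\<exists>P. path_system P (set xs \<inter> X) \<and> {e\<in>path_edges xs. e \<subseteq> X} = system_edges P \<and>
    (xs \<noteq> [] \<and> hd xs \<in> X \<longrightarrow> (\<exists>p\<in>P. p \<noteq> [] \<and> hd p = hd xs))"
  using assms
proof (induction xs)
  case Nil
  show ?case by (intro exI[of _ "{}"]) (auto simp: path_system_def system_edges_def)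
next
  case (Cons x xs)
  then obtain P where P: "path_system P (set xs \<inter> X)" "{e\<in>path_edges xs. e \<subseteq> X} = system_edges P"
    "xs \<noteq> [] \<and> hd xs \<in> X \<longrightarrow> (\<exists>p\<in>P. p \<noteq> [] \<and> hd p = hd xs)"
    by auto
  have x: "x \<notin> set q" if "q \<in> P" for q
    using P(1) Cons.prems that by (auto simp: path_system_def)
  consider "x \<notin> X" | "x \<in> X" "xs = [] \<or> hd xs \<notin> X" | "x \<in> X" "xs \<noteq> []" "hd xs \<in> X" by blast
  then show ?case
  proof cases
    case 1
    then have "{e\<in>path_edges (x # xs). e \<subseteq> X} = {e\<in>path_edges xs. e \<subseteq> X}"
      by (cases "xs = []") (auto simp: path_edges_Cons)
    then show ?thesis using 1 P by (intro exI[of _ P]) auto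
  next
    case 2
    then have "{e\<in>path_edges (x # xs). e \<subseteq> X} = {e\<in>path_edges xs. e \<subseteq> X}"
      by (cases "xs = []") (auto simp: path_edges_Cons)
    moreover have "system_edges (insert [x] P) = system_edges P"
      by (simp add: system_edges_def)
    moreover have "path_system (insert [x] P) (set (x # xs) \<inter> X)"
      using P(1) x 2(1) by (auto simp: path_system_def)
    ultimately show ?thesis using P(2) by (intro exI[of _ "insert [x] P"]) auto
  next
    case 3
    then obtain p where p: "p \<in> P" "p \<noteq> []" "hd p = hd xs" using P(3) by auto
    define P' where "P' = insert (x # p) (P - {p})"
    have "{e\<in>path_edges (x # xs). e \<subseteq> X} = insert {x, hd xs} {e\<in>path_edges xs. e \<subseteq> X}"
      using 3 by (auto simp: path_edges_Cons)
    moreover have "system_edges P' = insert {x, hd xs} (system_edges P)"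
      using p by (auto simp: system_edges_def P'_def path_edges_Cons)
    moreover have "path_system P' (set (x # xs) \<inter> X)"
    proof -
      have P1: "\<forall>q\<in>P. distinct q" "\<And>q r. q \<in> P \<Longrightarrow> r \<in> P \<Longrightarrow> q \<noteq> r \<Longrightarrow> set q \<inter> set r = {}"
          "\<Union> (set ` P) = set xs \<inter> X"
        using P(1) by (simp_all add: path_system_def)
      have "P = insert p (P - {p})" using p by auto
      then have "\<Union> (set ` P) = set p \<union> \<Union> (set ` (P - {p}))" by (metis UN_insert)
      then have "\<Union> (set ` P') = set (x # xs) \<inter> X"
        using P1(3) 3(1) by (auto simp: P'_def)
      moreover have "set (x # p) \<inter> set q = {}" if "q \<in> P - {p}" for q
        using P1(2)[of p q] x[of q] p(1) that by auto
      ultimately show ?thesis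
        using P1(1,2) p(1) x[OF p(1)] unfolding path_system_def P'_def by (simp add: Int_commute)
    qed
    ultimately show ?thesis
      using P(2) by (intro exI[of _ P']) (auto simp: P'_def)
  qed
qed

lemma path_edges_map: "path_edges (map f p) = (`) f ` path_edges p"
  by (induction p rule: path_edges.induct) auto

lemma system_edges_map: "system_edges (map f ` P) = (`) f ` system_edges P"
  by (auto simp: system_edges_def path_edges_map)

lemma path_system_map:
  assumes "path_system P S" "inj_on f S"
  shows "path_system (map f ` P) (f ` S)"
proof -
  have sub: "set p \<subseteq> S" if "p \<in> P" for p
    using assms(1) that by (auto simp: path_system_def)
  have "distinct (map f p)" if "p \<in> P" for p
    using assms sub[OF that] that by (auto simp: path_system_def distinct_map intro: inj_on_subset)
  moreover have "set (map f p) \<inter> set (map f q) = {}" if "p \<in> P" "q \<in> P" "map f p \<noteq> map f q" for p q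
  proof -
    have "p \<noteq> q" using that(3) by auto
    then have "set p \<inter> set q = {}" using assms(1) that(1,2) by (simp add: path_system_def)
    then show ?thesis
      using inj_on_image_Int[OF assms(2) sub[OF that(1)] sub[OF that(2)]] by simp
  qed
  moreover have "\<Union> (set ` map f ` P) = f ` S"
    using assms(1) by (auto simp: path_system_def)
  ultimately show ?thesis unfolding path_system_def by blast
qed

section \<open>Crossing segments and the edges inside one chain\<close>

lemma segments_meet:
  assumes "orient b d a * orient b d c < 0" "orient a c b * orient a c d < 0"
  shows "closed_segment a c \<inter> closed_segment b d \<noteq> {}"
proof -
  \<comment> \<open>Cramer's rule: \<open>s\<close> and \<open>r\<close> are the parameters of the
    intersection point on the lines through \<open>a\<close>, \<open>c\<close> and through
    \<open>b\<close>, \<open>d\<close>. The sign conditions place both in the unit interval, and by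
    \<open>D\<close> the denominators agree up to sign.\<close>
  define s where "s = orient b d a / (orient b d a - orient b d c)"
  define r where "r = orient a c b / (orient a c b - orient a c d)"
  have unit: "0 \<le> x / (x - y) \<and> x / (x - y) \<le> 1" if "x * y < 0" for x y :: real
    using that by (auto simp: mult_less_0_iff field_simps)
  have sr: "0 \<le> s" "s \<le> 1" "0 \<le> r" "r \<le> 1"
    using unit[OF assms(1)] unit[OF assms(2)] by (simp_all add: s_def r_def)
  have D: "orient a c b - orient a c d = - (orient b d a - orient b d c)"
    by (simp add: orient_def algebra_simps)
  have ne: "orient b d a - orient b d c \<noteq> 0"
    using assms(1) by (auto simp: mult_less_0_iff)
  have "(1 - s) *\<^sub>R a + s *\<^sub>R c = (1 - r) *\<^sub>R b + r *\<^sub>R d"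
  proof -
    define k where "k = orient b d a - orient b d c"
    have k: "k \<noteq> 0" "s = orient b d a / k"
      using ne by (simp_all add: k_def s_def)
    have r: "r = - orient a c b / k"
      by (simp only: r_def D k_def divide_minus_right minus_divide_left)
    have 1: "(k - orient b d a) * fst a + orient b d a * fst c
          = (k + orient a c b) * fst b - orient a c b * fst d"
      "(k - orient b d a) * snd a + orient b d a * snd c
          = (k + orient a c b) * snd b - orient a c b * snd d"
      unfolding k_def orient_def by algebra+
    have "k * ((1 - s) * fst a + s * fst c) = k * ((1 - r) * fst b + r * fst d)"
      "k * ((1 - s) * snd a + s * snd c) = k * ((1 - r) * snd b + r * snd d)"
      using 1 k by (simp_all add: r algebra_simps)
    then show ?thesis using k(1) by (simp add: prod_eq_iff)
  qed
  moreover have "(1 - s) *\<^sub>R a + s *\<^sub>R c \<in> closed_segment a c"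
    "(1 - r) *\<^sub>R b + r *\<^sub>R d \<in> closed_segment b d"
    using sr unfolding closed_segment_def by auto
  ultimately show ?thesis by auto
qed

lemma orient_cycle: "orient q r p = orient p q r"
  by (simp add: orient_def algebra_simps)

lemma orient_swap: "orient p r q = - orient p q r"
  by (simp add: orient_def algebra_simps)

lemma chain_inj_on: "cap_chain C \<or> cup_chain C \<Longrightarrow> inj_on fst C"
  unfolding cap_chain_def cup_chain_def by blast

text \<open>Changing from cap to cup flips all orientations at once, so the products tested by
  \<open>segments_meet\<close> are negative in both cases.\<close>

lemma chain_segments_meet:
  assumes "cap_chain C \<or> cup_chain C" "a \<in> C" "b \<in> C" "c \<in> C" "d \<in> C"
    "fst a < fst b" "fst b < fst c" "fst c < fst d"
  shows "closed_segment a c \<inter> closed_segment b d \<noteq> {}"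
proof (rule segments_meet)
  have lt: "fst a < fst d" "fst b < fst d" "fst a < fst c" using assms by auto
  have o: "orient b d a = - orient a d b" "orient a c d = - orient a d c"
    by (metis orient_cycle orient_swap)+
  show "orient b d a * orient b d c < 0" "orient a c b * orient a c d < 0"
    using assms lt unfolding o cap_chain_def cup_chain_def mult_less_0_iff neg_less_0_iff_less neg_0_less_iff_less
    by blast+
qed

lemma plane_cycle:
  assumes "non_crossing vs" "{a, c} \<in> cycle_edges vs" "{b, d} \<in> cycle_edges vs" "{a, c} \<inter> {b, d} = {}"
  shows "closed_segment a c \<inter> closed_segment b d = {}"
proof -
  obtain i j where ij: "i < length vs" "j < length vs" "{a, c} = cyc_edge vs i" "{b, d} = cyc_edge vs j"
    using assms(2,3) by (auto simp: cycle_edges_def)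
  then have "closed_segment a c = seg vs i" "closed_segment b d = seg vs j"
    by (auto simp: seg_def cyc_edge_def doubleton_eq_iff closed_segment_commute)
  moreover have "i \<noteq> j" using ij assms(4) by auto
  ultimately show ?thesis
    using assms(1,4) ij unfolding non_crossing_def by metis
qed

lemma pair_of_image:
  assumes "inj_on f S" "e \<subseteq> S" "f ` e = {a, c}"
  obtains A C where "e = {A, C}" "f A = a" "f C = c"
proof -
  have "a \<in> f ` e" "c \<in> f ` e" using assms(3) by auto
  then obtain A C where AC: "A \<in> e" "f A = a" "C \<in> e" "f C = c" by auto
  have "x = A \<or> x = C" if "x \<in> e" for x
  proof -
    have "f x = f A \<or> f x = f C" using assms(3) AC that by blast
    then show ?thesis using assms(1,2) AC that by (meson inj_on_def subsetD)
  qed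
  then have "e = {A, C}" using AC by auto
  then show ?thesis using that AC by blast
qed

text \<open>Started at \<open>v\<close> outside \<open>U\<close>, the cycle has no closing edge
  within \<open>U\<close>, so its edges there come from a path cut into pieces. Interleaving
  abscissae would make two disjoint edges meet.\<close>

lemma chain_restriction_forest:
  assumes "ham_cycle vs S" "non_crossing vs" "cap_chain U \<or> cup_chain U" "U \<subseteq> S" "v \<in> S - U"
  shows "(`) fst ` {e\<in>cycle_edges vs. e \<subseteq> U} \<in> forests (fst ` U)"
proof -
  have inj: "inj_on fst U" using assms(3) by (rule chain_inj_on)
  obtain ws where ws: "ham_cycle (v # ws) S" "cycle_edges (v # ws) = cycle_edges vs"
    using ham_cycle_start_at assms(1,5) by blast
  have "{e\<in>cycle_edges vs. e \<subseteq> U} = {e\<in>path_edges (v # ws). e \<subseteq> U}"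
    using assms(5) by (auto simp: ws(2)[symmetric] cycle_edges_conv_path)
  moreover obtain P where "path_system P (set (v # ws) \<inter> U)"
    "{e\<in>path_edges (v # ws). e \<subseteq> U} = system_edges P"
    using path_edges_restrict[of "v # ws" U] ws(1) unfolding ham_cycle_def by blast
  moreover have "set (v # ws) \<inter> U = U" using ws(1) assms(4) by (auto simp: ham_cycle_def)
  ultimately have P: "path_system P U" "{e\<in>cycle_edges vs. e \<subseteq> U} = system_edges P" by simp_all
  have no: False if e: "e \<in> cycle_edges vs" "f \<in> cycle_edges vs" "e \<subseteq> U" "f \<subseteq> U"
    and abcd: "a < b" "b < c" "c < d" "fst ` e = {a, c}" "fst ` f = {b, d}" for e f a b c d
  proof -
    obtain A C where AC: "e = {A, C}" "fst A = a" "fst C = c"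
      using pair_of_image[OF inj e(3) abcd(4)] .
    obtain B D where BD: "f = {B, D}" "fst B = b" "fst D = d"
      using pair_of_image[OF inj e(4) abcd(5)] .
    have "{A, C} \<inter> {B, D} = {}" using AC BD abcd by auto
    then show False
      using plane_cycle[OF assms(2), of A C B D] chain_segments_meet[OF assms(3), of A B C D] AC BD e abcd
      by simp
  qed
  have "crossing_free ((`) fst ` {e\<in>cycle_edges vs. e \<subseteq> U})"
    unfolding crossing_free_def crossing_def by (clarsimp, metis no)
  then show ?thesis
    using path_system_map[OF P(1) inj] unfolding P(2) forests_def system_edges_map[symmetric] by blast
qed

section \<open>Staircases and their degrees\<close>

lemma staircase_corner:
  fixes M :: "('a::linorder \<times> 'b::linorder) set"
  assumes "finite M" "M \<noteq> {}" "\<And>x y x' y'. (x, y) \<in> M \<Longrightarrow> (x', y') \<in> M \<Longrightarrow> x < x' \<Longrightarrow> y \<le> y'"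
  shows "(Min (fst ` M), Min (snd ` M)) \<in> M"
proof -
  have "Min (fst ` M) \<in> fst ` M" "Min (snd ` M) \<in> snd ` M" using assms by auto
  then obtain x y where xy: "(Min (fst ` M), y) \<in> M" "(x, Min (snd ` M)) \<in> M" by auto
  then have le: "Min (fst ` M) \<le> x" "Min (snd ` M) \<le> y"
    using assms(1) by (force intro!: Min_le)+
  show ?thesis
  proof (cases "x = Min (fst ` M)")
    case False
    \<comment> \<open>The pair with the smallest second coordinate now has a larger first
      coordinate, so monotonicity forces \<open>y\<close> down to the minimum.\<close>
    then have "y \<le> Min (snd ` M)" using assms(3)[OF xy] le by simp
    then show ?thesis using le xy by (metis antisym)
  qed (use xy in simp)
qed

text \<open>A crossing-free bipartite graph between two facing chains is a staircase, and a staircase can be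
  rebuilt greedily from its degrees, starting at the corner.\<close>
lemma staircase_unique:
  fixes M N :: "('a::linorder \<times> 'b::linorder) set"
  assumes "finite M" "finite N"
    "\<And>x y x' y'. (x, y) \<in> M \<Longrightarrow> (x', y') \<in> M \<Longrightarrow> x < x' \<Longrightarrow> y \<le> y'"
    "\<And>x y x' y'. (x, y) \<in> N \<Longrightarrow> (x', y') \<in> N \<Longrightarrow> x < x' \<Longrightarrow> y \<le> y'"
    "\<And>x. card {y. (x, y) \<in> M} = card {y. (x, y) \<in> N}"
    "\<And>y. card {x. (x, y) \<in> M} = card {x. (x, y) \<in> N}"
  shows "M = N"
  using assms
proof (induction "card M" arbitrary: M N)
  have fin: "finite {y. (x, y) \<in> R}" "finite {x. (x, z) \<in> R}" if "finite R"
    for R :: "('a \<times> 'b) set" and x z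
  proof -
    have "{y. (x, y) \<in> R} \<subseteq> snd ` R" "{x. (x, z) \<in> R} \<subseteq> fst ` R" by force+
    then show "finite {y. (x, y) \<in> R}" "finite {x. (x, z) \<in> R}"
      using that by (meson finite_imageI finite_subset)+
  qed
  {
    case 0
    then have "M = {}" by simp
    then have "{y. (x, y) \<in> N} = {}" for x
      using 0(6)[of x] fin(1)[OF 0(3), of x] by simp
    then show ?case using \<open>M = {}\<close> by auto
  next
    case (Suc m)
    have fst: "x \<in> fst ` R \<longleftrightarrow> card {y. (x, y) \<in> R} \<noteq> 0"
      and snd: "z \<in> snd ` R \<longleftrightarrow> card {x. (x, z) \<in> R} \<noteq> 0" if "finite R" for R :: "('a \<times> 'b) set" and x z
      using fin[OF that] by (force simp: image_iff)+
    \<comment> \<open>A coordinate occurs exactly when its degree is nonzero, so both staircases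
      have the same projections and hence the same corner.\<close>
    have eq: "fst ` M = fst ` N" "snd ` M = snd ` N"
      using fst[OF Suc.prems(1)] fst[OF Suc.prems(2)] snd[OF Suc.prems(1)] snd[OF Suc.prems(2)] Suc.prems(5,6)
      by (intro set_eqI; simp)+
    define x0 where "x0 = Min (fst ` M)"
    define y0 where "y0 = Min (snd ` M)"
    have "M \<noteq> {}" "N \<noteq> {}" using Suc.hyps(2) eq by auto
    then have in_M: "(x0, y0) \<in> M" and in_N: "(x0, y0) \<in> N"
      using staircase_corner[OF Suc.prems(1)] staircase_corner[OF Suc.prems(2)] Suc.prems(3,4) eq
      by (auto simp: x0_def y0_def)
    have row: "card {y. (x, y) \<in> R - {(x0, y0)}} = card {y. (x, y) \<in> R} - (if x = x0 then 1 else 0)"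
      and col: "card {x. (x, z) \<in> R - {(x0, y0)}} = card {x. (x, z) \<in> R} - (if z = y0 then 1 else 0)"
      if "finite R" "(x0, y0) \<in> R" for R x z
    proof -
      have "{y. (x, y) \<in> R - {(x0, y0)}} = {y. (x, y) \<in> R} - (if x = x0 then {y0} else {})"
        "{x. (x, z) \<in> R - {(x0, y0)}} = {x. (x, z) \<in> R} - (if z = y0 then {x0} else {})"
        by auto
      then show "card {y. (x, y) \<in> R - {(x0, y0)}} = card {y. (x, y) \<in> R} - (if x = x0 then 1 else 0)"
        "card {x. (x, z) \<in> R - {(x0, y0)}} = card {x. (x, z) \<in> R} - (if z = y0 then 1 else 0)"
        using that fin[OF that(1)] by auto
    qed
    have "M - {(x0, y0)} = N - {(x0, y0)}"
    proof (rule Suc.hyps(1))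
      show "m = card (M - {(x0, y0)})"
        using Suc.hyps(2) Suc.prems(1) in_M by simp
      show "card {y. (x, y) \<in> M - {(x0, y0)}} = card {y. (x, y) \<in> N - {(x0, y0)}}" for x
        using row[OF Suc.prems(1) in_M] row[OF Suc.prems(2) in_N] Suc.prems(5) by simp
      show "card {x. (x, y) \<in> M - {(x0, y0)}} = card {x. (x, y) \<in> N - {(x0, y0)}}" for y
        using col[OF Suc.prems(1) in_M] col[OF Suc.prems(2) in_N] Suc.prems(6) by simp
    qed (use Suc.prems(1-4) in \<open>blast+\<close>)
    then show ?case using in_M in_N by blast
  }
qed

section \<open>Edges between the two chains\<close>

lemma double_chainD:
  assumes "double_chain U L n"
  shows "finite U" "finite L" "U \<inter> L = {}" "card U = n" "card L = n"
    "cap_chain U \<or> cup_chain U" "cap_chain L \<or> cup_chain L" "inj_on fst U" "inj_on fst L"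
proof -
  show "finite U" "finite L" "U \<inter> L = {}" "card U = n" "card L = n"
    and chains: "cap_chain U \<or> cup_chain U" "cap_chain L \<or> cup_chain L"
    using assms unfolding double_chain_def by (elim conjE; blast)+
  show "inj_on fst U" "inj_on fst L"
    using chain_inj_on[OF chains(1)] chain_inj_on[OF chains(2)] .
qed

lemma double_chain_sides:
  assumes "double_chain U L n"
  shows "a \<in> U \<Longrightarrow> b \<in> U \<Longrightarrow> fst a < fst b \<Longrightarrow> l \<in> L \<Longrightarrow> orient a b l < 0"
    and "a \<in> L \<Longrightarrow> b \<in> L \<Longrightarrow> fst a < fst b \<Longrightarrow> u \<in> U \<Longrightarrow> orient a b u > 0"
  using assms by (simp_all add: double_chain_def)

text \<open>The two edges at \<open>u\<close> either stay inside \<open>U\<close> or lead to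
  \<open>L\<close>. The latter are counted by abscissae to match the rows of
  \<open>cross_edges\<close>; exchanging the chains covers the columns.\<close>

lemma bipartite_degree:
  assumes "ham_cycle vs (U \<union> L)" "U \<inter> L = {}" "finite U" "finite L" "u \<in> U" "inj_on fst L"
  shows "card {e\<in>cycle_edges vs. e \<subseteq> U \<and> u \<in> e} + card {fst l |l. l \<in> L \<and> {u, l} \<in> cycle_edges vs} = 2"
proof -
  let ?A = "{e\<in>cycle_edges vs. e \<subseteq> U \<and> u \<in> e}"
  let ?N = "{l\<in>L. {u, l} \<in> cycle_edges vs}"
  let ?B = "(\<lambda>l. {u, l}) ` ?N"
  have "{e\<in>cycle_edges vs. u \<in> e} = ?A \<union> ?B"
  proof (intro equalityI subsetI)
    fix e assume e: "e \<in> {e\<in>cycle_edges vs. u \<in> e}"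
    then obtain x y where xy: "e = {x, y}" "x \<in> U \<union> L" "y \<in> U \<union> L"
      using cycle_edges_pair[OF assms(1)] by blast
    have "u = x \<or> u = y" using e xy(1) by simp
    then obtain w where "e = {u, w}" "w \<in> U \<union> L" using xy by (metis insert_commute)
    then show "e \<in> ?A \<union> ?B" using e assms(5) by blast
  qed auto
  moreover have "?A \<inter> ?B = {}" using assms(2) by auto
  moreover have "finite ?A" "finite ?B"
    using assms(3,4) by (auto simp: cycle_edges_def)
  ultimately have "card ?A + card ?B = 2"
    using cycle_degree[OF assms(1), of u] assms(5) card_Un_disjoint[of ?A ?B] by simp
  moreover have "inj_on (\<lambda>l. {u, l}) ?N"
    by (auto simp: inj_on_def doubleton_eq_iff)
  then have "card ?B = card ?N" by (rule card_image)
  moreover have "card (fst ` ?N) = card ?N"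
    using assms(6) by (intro card_image) (auto intro: inj_on_subset)
  moreover have "fst ` ?N = {fst l |l. l \<in> L \<and> {u, l} \<in> cycle_edges vs}" by blast
  ultimately show ?thesis by simp
qed

text \<open>Abscissae identify points within each chain and supply the linear orders in which the
  edges form a staircase.\<close>

definition cross_edges :: "point set \<Rightarrow> point set \<Rightarrow> point set set \<Rightarrow> (real \<times> real) set" where
  "cross_edges U L E = {(fst u, fst l) |u l. u \<in> U \<and> l \<in> L \<and> {u, l} \<in> E}"

lemma cross_edges_row:
  assumes "inj_on fst U" "u \<in> U"
  shows "{y. (fst u, y) \<in> cross_edges U L E} = {fst l |l. l \<in> L \<and> {u, l} \<in> E}"
proof (intro equalityI subsetI)
  fix y assume "y \<in> {y. (fst u, y) \<in> cross_edges U L E}"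
  then obtain u' l where *: "u' \<in> U" "l \<in> L" "{u', l} \<in> E" "fst u = fst u'" "y = fst l"
    unfolding cross_edges_def by blast
  then have "u = u'" using inj_onD[OF assms(1)] assms(2) by metis
  then show "y \<in> {fst l |l. l \<in> L \<and> {u, l} \<in> E}" using * by blast
qed (use assms(2) in \<open>unfold cross_edges_def, blast\<close>)

lemma cross_edges_col:
  assumes "inj_on fst L" "l \<in> L"
  shows "{x. (x, fst l) \<in> cross_edges U L E} = {fst u |u. u \<in> U \<and> {l, u} \<in> E}"
proof (intro equalityI subsetI)
  fix x assume "x \<in> {x. (x, fst l) \<in> cross_edges U L E}"
  then obtain u l' where *: "u \<in> U" "l' \<in> L" "{u, l'} \<in> E" "fst l = fst l'" "x = fst u"
    unfolding cross_edges_def by blast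
  then have "l = l'" using inj_onD[OF assms(1)] assms(2) by metis
  then have "{l, u} \<in> E" using *(3) by (simp add: insert_commute)
  then show "x \<in> {fst u |u. u \<in> U \<and> {l, u} \<in> E}" using * by blast
next
  fix x assume "x \<in> {fst u |u. u \<in> U \<and> {l, u} \<in> E}"
  then obtain u where "u \<in> U" "{u, l} \<in> E" "x = fst u" by (auto simp: insert_commute)
  then show "x \<in> {x. (x, fst l) \<in> cross_edges U L E}"
    using assms(2) unfolding cross_edges_def by blast
qed

text \<open>If the order were reversed, then \<open>L\<close> lying below the line through
  \<open>u\<close>, \<open>u'\<close> and \<open>U\<close> above the line through \<open>l'\<close>,
  \<open>l\<close> would put the ends of each of the two edges on opposite sides of the other, so
  the edges would meet.\<close>

lemma cross_edges_mono:
  assumes "double_chain U L n" "non_crossing vs"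
    "(x, y) \<in> cross_edges U L (cycle_edges vs)" "(x', y') \<in> cross_edges U L (cycle_edges vs)" "x < x'"
  shows "y \<le> y'"
proof (rule ccontr)
  assume "\<not> y \<le> y'"
  obtain u l u' l' where
    ul: "u \<in> U" "l \<in> L" "{u, l} \<in> cycle_edges vs" "x = fst u" "y = fst l" and
    ul': "u' \<in> U" "l' \<in> L" "{u', l'} \<in> cycle_edges vs" "x' = fst u'" "y' = fst l'"
    using assms(3,4) by (auto simp: cross_edges_def)
  have lt: "fst u < fst u'" "fst l' < fst l" using ul ul' assms(5) \<open>\<not> y \<le> y'\<close> by auto
  have "orient u u' l < 0" "orient u u' l' < 0" "orient l' l u > 0" "orient l' l u' > 0"
    using double_chain_sides[OF assms(1)] ul(1,2) ul'(1,2) lt by blast+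
  moreover have "orient u' l' u = orient u u' l'" "orient u' l' l = orient l' l u'"
    "orient u l u' = - orient u u' l" "orient u l l' = - orient l' l u"
    by (simp_all add: orient_def algebra_simps)
  ultimately have "closed_segment u l \<inter> closed_segment u' l' \<noteq> {}"
    by (intro segments_meet) (simp_all add: mult_less_0_iff)
  moreover have "{u, l} \<inter> {u', l'} = {}"
    using lt ul(1,2) ul'(1,2) double_chainD(3)[OF assms(1)] by auto
  ultimately show False using plane_cycle[OF assms(2) ul(3) ul'(3)] by blast
qed

text \<open>Two minus the number of inner edges at a vertex is its number of cross edges. Equal
  inner edges thus give equal row and column sizes, and \<open>staircase_unique\<close> recovers the
  cross edges.\<close>

lemma polygonization_determined:
  assumes D: "double_chain U L n"
    and E: "ham_cycle vs (U \<union> L)" "non_crossing vs" and F: "ham_cycle ws (U \<union> L)" "non_crossing ws"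
    and U: "{e\<in>cycle_edges vs. e \<subseteq> U} = {e\<in>cycle_edges ws. e \<subseteq> U}"
    and L: "{e\<in>cycle_edges vs. e \<subseteq> L} = {e\<in>cycle_edges ws. e \<subseteq> L}"
  shows "cycle_edges vs = cycle_edges ws"
proof -
  let ?M = "\<lambda>vs. cross_edges U L (cycle_edges vs)"
  note fin = double_chainD(1,2)[OF D] and disj = double_chainD(3)[OF D]
    and inj = double_chainD(8,9)[OF D]
  have disj': "L \<inter> U = {}" and vert: "ham_cycle vs (L \<union> U)" "ham_cycle ws (L \<union> U)"
    using disj E(1) F(1) by (simp_all add: Int_commute Un_commute)
  have finM: "finite (?M xs)" for xs
  proof (rule finite_subset)
    show "?M xs \<subseteq> fst ` U \<times> fst ` L" unfolding cross_edges_def by blast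
  qed (use fin in simp)
  note row = cross_edges_row[OF inj(1)] and col = cross_edges_col[OF inj(2)]
  have "?M vs = ?M ws"
  proof (rule staircase_unique[OF finM finM])
    show "y \<le> y'" if "(x, y) \<in> ?M vs" "(x', y') \<in> ?M vs" "x < x'" for x y x' y'
      using cross_edges_mono[OF D E(2)] that by blast
    show "y \<le> y'" if "(x, y) \<in> ?M ws" "(x', y') \<in> ?M ws" "x < x'" for x y x' y'
      using cross_edges_mono[OF D F(2)] that by blast
    show "card {y. (x, y) \<in> ?M vs} = card {y. (x, y) \<in> ?M ws}" for x
    proof (cases "x \<in> fst ` U")
      case True
      then obtain u where u: "u \<in> U" "x = fst u" by auto
      have "{e\<in>cycle_edges vs. e \<subseteq> U \<and> u \<in> e} = {e\<in>cycle_edges ws. e \<subseteq> U \<and> u \<in> e}"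
        using U by blast
      then show ?thesis
        using bipartite_degree[OF E(1) disj fin u(1) inj(2)]
          bipartite_degree[OF F(1) disj fin u(1) inj(2)]
        by (simp add: u(2) row[OF u(1)])
    next
      case False
      then have "{y. (x, y) \<in> ?M xs} = {}" for xs unfolding cross_edges_def by blast
      then show ?thesis by simp
    qed
    show "card {x. (x, y) \<in> ?M vs} = card {x. (x, y) \<in> ?M ws}" for y
    proof (cases "y \<in> fst ` L")
      case True
      then obtain l where l: "l \<in> L" "y = fst l" by auto
      have "{e\<in>cycle_edges vs. e \<subseteq> L \<and> l \<in> e} = {e\<in>cycle_edges ws. e \<subseteq> L \<and> l \<in> e}"
        using L by blast
      then show ?thesis
        using bipartite_degree[of vs L U l] bipartite_degree[of ws L U l]
          vert disj' fin l(1) inj(1)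
        by (simp add: l(2) col[OF l(1)])
    next
      case False
      then have "{x. (x, y) \<in> ?M xs} = {}" for xs unfolding cross_edges_def by blast
      then show ?thesis by simp
    qed
  qed
  then have mixed: "{u, l} \<in> cycle_edges vs \<longleftrightarrow> {u, l} \<in> cycle_edges ws"
    if ul: "u \<in> U" "l \<in> L" for u l
  proof -
    have "(fst u, fst l) \<in> ?M xs \<longleftrightarrow> {u, l} \<in> cycle_edges xs" for xs
    proof
      assume "(fst u, fst l) \<in> ?M xs"
      then obtain l' where "l' \<in> L" "{u, l'} \<in> cycle_edges xs" "fst l = fst l'"
        using row[OF ul(1), of L "cycle_edges xs"] by blast
      then show "{u, l} \<in> cycle_edges xs"
        using inj_onD[OF inj(2), of l l'] ul(2) by simp
    qed (use ul in \<open>unfold cross_edges_def, blast\<close>)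
    from this[of vs] this[of ws] show ?thesis using \<open>?M vs = ?M ws\<close> by simp
  qed
  have iff: "e \<in> cycle_edges vs \<longleftrightarrow> e \<in> cycle_edges ws"
    if e: "e = {x, y}" "x \<in> U \<union> L" "y \<in> U \<union> L" for e x y
  proof -
    consider "x \<in> U" "y \<in> U" | "x \<in> L" "y \<in> L" | "x \<in> U" "y \<in> L" | "x \<in> L" "y \<in> U"
      using e by blast
    then show ?thesis
    proof cases
      case 1 then show ?thesis using U e(1) by blast
    next
      case 2 then show ?thesis using L e(1) by blast
    next
      case 3 then show ?thesis using mixed e(1) by blast
    next
      case 4 then show ?thesis using mixed[of y x] e(1) by (simp add: insert_commute)
    qed
  qed
  show ?thesis
    using cycle_edges_pair[OF E(1)] cycle_edges_pair[OF F(1)] iff by blast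
qed

section \<open>Counting polygonizations\<close>

lemma card_polygonizations_le:
  assumes D: "double_chain U L n"
  shows "card (polygonizations (U \<union> L)) \<le> forest_count n * forest_count n"
proof -
  \<comment> \<open>Projecting to abscissae moves the inner edges to sets of reals, over which
    \<open>forest_count\<close> ranges; nothing is lost, since \<open>fst\<close> is injective on
    each chain and this lifts through two power sets.\<close>
  define g where "g X E = (`) fst ` {e\<in>E. e \<subseteq> X}" for X :: "point set" and E
  note fin = double_chainD(1,2)[OF D] and disj = double_chainD(3)[OF D]
    and card = double_chainD(4,5)[OF D] and chain = double_chainD(6,7)[OF D]
    and inj = double_chainD(8,9)[OF D]
  have g_eq: "{e\<in>E. e \<subseteq> X} = {e\<in>F. e \<subseteq> X}" if "g X E = g X F" "inj_on fst X" for X E F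
    using inj_on_image_Pow[OF inj_on_image_Pow[OF that(2)]] that(1)
    unfolding g_def by (rule inj_onD) auto
  have "inj_on (\<lambda>E. (g U E, g L E)) (polygonizations (U \<union> L))"
  proof (rule inj_onI)
    fix E F assume "E \<in> polygonizations (U \<union> L)" "F \<in> polygonizations (U \<union> L)"
      and eq: "(g U E, g L E) = (g U F, g L F)"
    then obtain vs ws where vs: "ham_cycle vs (U \<union> L)" "non_crossing vs" "E = cycle_edges vs"
      and ws: "ham_cycle ws (U \<union> L)" "non_crossing ws" "F = cycle_edges ws"
      unfolding polygonizations_def by blast
    have "{e\<in>E. e \<subseteq> U} = {e\<in>F. e \<subseteq> U}" "{e\<in>E. e \<subseteq> L} = {e\<in>F. e \<subseteq> L}"
      using eq g_eq[OF _ inj(1)] g_eq[OF _ inj(2)] by blast+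
    then show "E = F"
      unfolding vs(3) ws(3) by (rule polygonization_determined[OF D vs(1,2) ws(1,2)])
  qed
  moreover have "(\<lambda>E. (g U E, g L E)) ` polygonizations (U \<union> L) \<subseteq> forests (fst ` U) \<times> forests (fst ` L)"
  proof clarify
    fix E assume "E \<in> polygonizations (U \<union> L)"
    then obtain vs where vs: "ham_cycle vs (U \<union> L)" "non_crossing vs" "E = cycle_edges vs"
      by (auto simp: polygonizations_def)
    \<comment> \<open>A polygonization has vertices, so neither chain is empty, and each provides
      the vertex off the other chain that \<open>chain_restriction_forest\<close> asks for.\<close>
    then have "U \<union> L \<noteq> {}" by (auto simp: ham_cycle_def)
    then have "n \<noteq> 0" using card fin by auto
    then have "U \<noteq> {}" "L \<noteq> {}" using card by auto
    then obtain u l where "u \<in> U" "l \<in> L" by blast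
    then have "l \<in> (U \<union> L) - U" "u \<in> (U \<union> L) - L" using disj by auto
    then show "g U E \<in> forests (fst ` U) \<and> g L E \<in> forests (fst ` L)"
      unfolding g_def vs(3)
      using chain_restriction_forest[OF vs(1,2) chain(1) Un_upper1]
        chain_restriction_forest[OF vs(1,2) chain(2) Un_upper2] by blast
  qed
  moreover have "finite (forests (fst ` U) \<times> forests (fst ` L))"
    using fin by (intro finite_cartesian_product finite_forests(1) finite_imageI)
  ultimately have "card (polygonizations (U \<union> L)) \<le> card (forests (fst ` U) \<times> forests (fst ` L))"
    by (rule card_inj_on_le)
  also have "\<dots> = card (forests (fst ` U)) * card (forests (fst ` L))"
    by (rule card_cartesian_product)
  also have "\<dots> \<le> forest_count n * forest_count n"
    using card_forests_le[of "fst ` U"] card_forests_le[of "fst ` L"] fin card inj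
    by (intro mult_mono) (auto simp: card_image)
  finally show ?thesis .
qed

theorem theorem3:
  shows "\<exists>C::real. \<forall>U L (n::nat). double_chain U L n \<longrightarrow>
           real (card (polygonizations (U \<union> L))) \<le> C * 5.610718614 ^ (2 * n)"
proof -
  obtain C :: real where C: "\<And>n. forest_count n \<le> C * 5.610718614 ^ n"
    using forest_count_bound by blast
  have "real (card (polygonizations (U \<union> L))) \<le> C\<^sup>2 * 5.610718614 ^ (2 * n)"
    if "double_chain U L n" for U L n
  proof -
    have "real (card (polygonizations (U \<union> L))) \<le> real (forest_count n * forest_count n)"
      using card_polygonizations_le[OF that] by (rule of_nat_mono)
    also have "\<dots> = (real (forest_count n))\<^sup>2"
      by (simp add: power2_eq_square)
    also have "\<dots> \<le> (C * 5.610718614 ^ n)\<^sup>2"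
      using C by (intro power_mono) auto
    also have "\<dots> = C\<^sup>2 * 5.610718614 ^ (2 * n)"
      by (simp add: power_mult_distrib power_mult mult.commute)
    finally show ?thesis .
  qed
  then show ?thesis by blast
qed

end
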